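(* Let $\mathfrak{X}$ be a homogeneous tree of degree $q+1$ with $q\ge 2$, with boundary $\Omega$. Let $1<p<2$, let $\frac1p+\frac1{p'}=1$, let $u:\mathfrak{X}\to\mathbb{C}$ be a function and let $z=\alpha+i\delta_{p'}$ with $\alpha\in\mathbb{R}$, where $\delta_{p'}=\frac1{p'}-\frac12$. Then $u=\mathcal{P}_zF$ on $\mathfrak{X}$ for some $F\in L^{p'}(\Omega)$ if and only if $u\in L^{p',\infty}(\mathfrak{X})$ and $\mathcal{L}u(x)=\gamma(z)u(x)$ for all $x\in\mathfrak{X}$. Moreover, there exist positive constants $C_1,C_2$ such that for all $F\in L^{p'}(\Omega)$, $$C_1\|\mathcal{P}_zF\|_{L^{p',\infty}(\mathfrak{X})}\le\|F\|_{L^{p'}(\Omega)}\le C_2\|\mathcal{P}_zF\|_{L^{p',\infty}(\mathfrak{X})}.$$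
   Context: Tree and boundary: $\mathfrak{X}$ is the homogeneous tree of degree $q+1$ ($q\ge2$ an integer), i.e. the connected graph without loops (cycles) in which every vertex has exactly $q+1$ neighbours; $\mathfrak{X}$ is identified with its vertex set, with counting measure and graph distance $d$. Fix a reference vertex $o$ and write $|x|=d(o,x)$. The boundary $\Omega$ is the set of all infinite geodesic rays $\omega=(\omega_0=o,\omega_1,\omega_2,\dots)$ starting at $o$. $\nu$ is the probability measure on $\Omega$ (with the $\sigma$-algebra generated by the sets $E(x)=\{\omega\in\Omega:\omega_{|x|}=x\}$, $x\in\mathfrak X$) invariant under the isometries of $\mathfrak{X}$ fixing $o$; explicitly $\nu(E(x))=\frac{q}{(q+1)q^{|x|}}$ for $|x|\ge1$. $L^{p'}(\Omega)$ is taken with respect to $\nu$. Poisson kernel and transform: for $x\in\mathfrak{X}$, $\omega\in\Omega$, let $c(x,\omega)$ be the last vertex lying on $\omega$ in the geodesic path from $o$ to $x$, let $h_\omega(x)=2|c(x,\omega)|-|x|$, and $p(x,\omega)=q^{h_\omega(x)}$ (not to be confused with the exponent $p$). For $z\in\mathbb{C}$, $p^{1/2+iz}(x,\omega)=q^{(1/2+iz)h_\omega(x)}$, and $$\mathcal{P}_zF(x)=\int_\Omega p^{1/2+iz}(x,\omega)F(\omega)\,d\nu(\omega),\qquad x\in\mathfrak{X}.$$ Laplacian: $\mathcal{L}u(x)=\frac1{q+1}\sum_{y:\,d(x,y)=1}u(y)$, and $\gamma(z)=\frac{q^{1/2+iz}+q^{1/2-iz}}{q+1}$. Weak $L^{p'}$: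 $\|u\|_{L^{p',\infty}(\mathfrak{X})}=\sup_{t>0}t\,\big(\#\{x\in\mathfrak{X}:|u(x)|>t\}\big)^{1/p'}$, and $L^{p',\infty}(\mathfrak{X})$ is the space of functions for which this is finite. *)

theory Defs
  imports "HOL-Probability.Probability"
begin

(* A graph is a symmetric irreflexive relation adj on the vertex type 'v; every element of the
   type is a vertex. *)

definition graph_cycle :: "('v \<Rightarrow> 'v \<Rightarrow> bool) \<Rightarrow> 'v list \<Rightarrow> bool" where
  "graph_cycle adj xs \<longleftrightarrow>
     3 \<le> length xs \<and> distinct xs \<and> successively adj xs \<and> adj (last xs) (hd xs)"

(* For finiteness of the neighbour sets note that card of an infinite set is 0. *)
definition homogeneous_tree :: "('v \<Rightarrow> 'v \<Rightarrow> bool) \<Rightarrow> nat \<Rightarrow> bool" where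
  "homogeneous_tree adj q \<longleftrightarrow>
     symp adj \<and> irreflp adj \<and>
     (\<forall>x y. adj\<^sup>*\<^sup>* x y) \<and>
     (\<nexists>xs. graph_cycle adj xs) \<and>
     (\<forall>x. card {y. adj x y} = q + 1)"

definition tdist :: "('v \<Rightarrow> 'v \<Rightarrow> bool) \<Rightarrow> 'v \<Rightarrow> 'v \<Rightarrow> nat" where
  "tdist adj x y = (LEAST n. (adj ^^ n) x y)"

definition is_geodesic :: "('v \<Rightarrow> 'v \<Rightarrow> bool) \<Rightarrow> 'v \<Rightarrow> 'v \<Rightarrow> 'v list \<Rightarrow> bool" where
  "is_geodesic adj x y xs \<longleftrightarrow>
     length xs = Suc (tdist adj x y) \<and> successively adj xs \<and> hd xs = x \<and> last xs = y"

(* Unique in a tree. *)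
definition geodesic_path :: "('v \<Rightarrow> 'v \<Rightarrow> bool) \<Rightarrow> 'v \<Rightarrow> 'v \<Rightarrow> 'v list" where
  "geodesic_path adj x y = (THE xs. is_geodesic adj x y xs)"

definition boundary :: "('v \<Rightarrow> 'v \<Rightarrow> bool) \<Rightarrow> 'v \<Rightarrow> (nat \<Rightarrow> 'v) set" where
  "boundary adj orig =
     {\<omega>. \<omega> 0 = orig \<and> (\<forall>m n. m \<le> n \<longrightarrow> tdist adj (\<omega> m) (\<omega> n) = n - m)}"

definition boundary_cyl :: "('v \<Rightarrow> 'v \<Rightarrow> bool) \<Rightarrow> 'v \<Rightarrow> 'v \<Rightarrow> (nat \<Rightarrow> 'v) set" where
  "boundary_cyl adj orig x = {\<omega> \<in> boundary adj orig. \<omega> (tdist adj orig x) = x}"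

definition tree_isometry :: "('v \<Rightarrow> 'v \<Rightarrow> bool) \<Rightarrow> ('v \<Rightarrow> 'v) \<Rightarrow> bool" where
  "tree_isometry adj f \<longleftrightarrow> bij f \<and> (\<forall>x y. tdist adj (f x) (f y) = tdist adj x y)"

(* On a homogeneous tree exactly one measure satisfies these conditions. The last two are
   equivalent given the others. *)
definition is_boundary_measure ::
    "('v \<Rightarrow> 'v \<Rightarrow> bool) \<Rightarrow> nat \<Rightarrow> 'v \<Rightarrow> (nat \<Rightarrow> 'v) measure \<Rightarrow> bool" where
  "is_boundary_measure adj q orig \<nu> \<longleftrightarrow>
     prob_space \<nu> \<and>
     space \<nu> = boundary adj orig \<and>
     sets \<nu> = sigma_sets (boundary adj orig) (range (boundary_cyl adj orig)) \<and>
     (\<forall>f. tree_isometry adj f \<and> f orig = orig \<longrightarrow> distr \<nu> \<nu> (\<lambda>\<omega>. f \<circ> \<omega>) = \<nu>) \<and>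
     (\<forall>x. 1 \<le> tdist adj orig x \<longrightarrow>
        measure \<nu> (boundary_cyl adj orig x) =
          real q / ((real q + 1) * real q ^ tdist adj orig x))"

definition confluent :: "('v \<Rightarrow> 'v \<Rightarrow> bool) \<Rightarrow> 'v \<Rightarrow> 'v \<Rightarrow> (nat \<Rightarrow> 'v) \<Rightarrow> 'v" where
  "confluent adj orig x \<omega> = last (filter (\<lambda>v. v \<in> range \<omega>) (geodesic_path adj orig x))"

definition horo :: "('v \<Rightarrow> 'v \<Rightarrow> bool) \<Rightarrow> 'v \<Rightarrow> (nat \<Rightarrow> 'v) \<Rightarrow> 'v \<Rightarrow> int" where
  "horo adj orig \<omega> x =
     2 * int (tdist adj orig (confluent adj orig x \<omega>)) - int (tdist adj orig x)"

(* The complex power p(x,omega)^s of the Poisson kernel p(x,omega) = q^h. *)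
definition poisson_kernel_pow ::
    "('v \<Rightarrow> 'v \<Rightarrow> bool) \<Rightarrow> nat \<Rightarrow> 'v \<Rightarrow> complex \<Rightarrow> 'v \<Rightarrow> (nat \<Rightarrow> 'v) \<Rightarrow> complex" where
  "poisson_kernel_pow adj q orig s x \<omega> = of_nat q powr (s * of_int (horo adj orig \<omega> x))"

definition poisson_transform ::
    "('v \<Rightarrow> 'v \<Rightarrow> bool) \<Rightarrow> nat \<Rightarrow> 'v \<Rightarrow> (nat \<Rightarrow> 'v) measure \<Rightarrow> complex \<Rightarrow>
     ((nat \<Rightarrow> 'v) \<Rightarrow> complex) \<Rightarrow> 'v \<Rightarrow> complex" where
  "poisson_transform adj q orig \<nu> z F x =
     (LINT \<omega>|\<nu>. poisson_kernel_pow adj q orig (1/2 + \<i> * z) x \<omega> * F \<omega>)"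

definition laplacian ::
    "('v \<Rightarrow> 'v \<Rightarrow> bool) \<Rightarrow> nat \<Rightarrow> ('v \<Rightarrow> complex) \<Rightarrow> 'v \<Rightarrow> complex" where
  "laplacian adj q u x = 1 / (of_nat q + 1) * (\<Sum>y \<in> {y. tdist adj x y = 1}. u y)"

definition gamma_eigenvalue :: "nat \<Rightarrow> complex \<Rightarrow> complex" where
  "gamma_eigenvalue q z =
     (of_nat q powr (1/2 + \<i> * z) + of_nat q powr (1/2 - \<i> * z)) / (of_nat q + 1)"

(* Functions rather than classes modulo null sets. *)
definition Lp_space :: "'a measure \<Rightarrow> real \<Rightarrow> ('a \<Rightarrow> complex) set" where
  "Lp_space M r = {F \<in> borel_measurable M. integrable M (\<lambda>\<omega>. norm (F \<omega>) powr r)}"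

definition Lp_norm :: "'a measure \<Rightarrow> real \<Rightarrow> ('a \<Rightarrow> complex) \<Rightarrow> real" where
  "Lp_norm M r F = (LINT \<omega>|M. norm (F \<omega>) powr r) powr (1 / r)"

definition weak_Lp_norm :: "real \<Rightarrow> ('v \<Rightarrow> complex) \<Rightarrow> ennreal" where
  "weak_Lp_norm r u =
     (SUP t \<in> {0<..}. if finite {x. norm (u x) > t}
        then ennreal (t * real (card {x. norm (u x) > t}) powr (1 / r)) else \<infinity>)"

definition weak_Lp_space :: "real \<Rightarrow> ('v \<Rightarrow> complex) set" where
  "weak_Lp_space r = {u. weak_Lp_norm r u < \<infinity>}"

end

theory Submission
  imports Defs
begin

text \<open>
Write $s = 1/2 + iz$ and $r = p'$, so that $r > 2$ and $\mathrm{Re}\,s = 1 - 1/r > 1/2$, and let $x^-$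
be the neighbour of $x \neq o$ that is closer to $o$.

Everything rests on one function, the slope $d(x) = u(x) - q^{-s} u(x^-)$. A boundary point outside
$E(x)$ sees $x$ one horocycle further away than $x^-$, hence its contributions to $u(x)$ and to
$q^{-s} u(x^-)$ cancel when $u$ is a Poisson transform, and what remains is
$d(x) = q^{s|x|} (1 - q^{-2s}) \int_{E(x)} F$ (\<open>slope_PT\<close>). On the other hand
the eigenvalue equation says that the sum of $d$ over the children of $x$ is $q^s d(x)$,
together with a condition at the root (\<open>eigenfunction_iff_slope\<close>); this is the additivity of
$x \mapsto \int_{E(x)} F$. So eigenfunctions correspond to finitely additive measures on the
cylinders, that is to martingales, and Poisson transforms of functions in $L^r$ to those
martingales that are closed by a function in $L^r$.

For the weak type estimate (\<open>weak_bound_PT\<close>), $F$ is truncated on the sphere of radius $n$ at a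
height proportional to $t q^{n/r}$. The bounded part contributes at most $t/2$, because
$\int |p^s(x,\cdot)| \, d\nu$ is of order $q^{-|x|/r}$; the large part is handled by the
$\ell^1$ norm over the sphere. The sum over $n$ is geometric and gives $t^{-r} \|F\|_r^r$.

Conversely, weak type information on $u$ alone bounds the $\ell^r$ norm of $d$ only on average over
spheres, whereas boundedness of the martingale in $L^r$ needs it on every single sphere. The
bound comes from the descendants (\<open>tsphere_sum_le_weak_bound\<close>): a vertex $y$ has $q^k$ descendants
in the $k$-th generation, and the sum of $d$ over them is $q^{sk} d(y)$, so that the average size
of $d$ there is at least $q^{-k/r} |d(y)|$. If $t$ is small and, for each $y$ on the sphere,
$k$ is chosen so that this number is about $t$, the blocks of descendants are
disjoint and together contain about $t^{-r} \sum_y |d(y)|^r$ vertices. By the weak type bound, this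
is at most a constant times $t^{-r} \|u\|^r$.

As $r > 2$, the martingale is bounded in $L^2$, so that orthogonality of its
increments makes it converge (\<open>Lp_bounded_martingale_closed\<close>); Fatou's lemma keeps the norm. This gives the
representation with its lower bound (\<open>eigenfunction_represented\<close>), and since $F$ is determined by its integrals over
cylinders, hence by its transform, the lower bound holds for every $F$.
\<close>

section \<open>The rooted tree\<close>

locale rooted_tree =
  fixes adj :: "'v \<Rightarrow> 'v \<Rightarrow> bool" and q :: nat and orig :: 'v
  assumes tree: "homogeneous_tree adj q" and q_ge_2: "2 \<le> q"
begin

abbreviation lev :: "'v \<Rightarrow> nat" where "lev \<equiv> tdist adj orig"

lemma adj_sym: "adj x y \<Longrightarrow> adj y x"
  using tree by (auto simp: homogeneous_tree_def dest: sympD)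

lemma adj_irrefl: "\<not> adj x x"
  using tree by (auto simp: homogeneous_tree_def dest: irreflpD)

lemma no_cycle: "\<not> graph_cycle adj xs"
  using tree by (auto simp: homogeneous_tree_def)

lemma card_neighbours: "card {y. adj x y} = q + 1"
  using tree by (auto simp: homogeneous_tree_def)

lemma tdist_path: "(adj ^^ tdist adj x y) x y"
proof -
  have "adj\<^sup>*\<^sup>* x y" using tree by (auto simp: homogeneous_tree_def)
  then obtain n where "(adj ^^ n) x y" by (auto dest: rtranclp_imp_relpowp)
  thus ?thesis unfolding tdist_def by (rule LeastI)
qed

lemma tdist_le: "(adj ^^ n) x y \<Longrightarrow> tdist adj x y \<le> n"
  unfolding tdist_def by (rule Least_le)

lemma lev_eq_0_iff [simp]: "lev x = 0 \<longleftrightarrow> x = orig"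
  using tdist_path[of orig x] tdist_le[of 0 orig x] by auto

lemma tdist_eq_1_iff: "tdist adj x y = 1 \<longleftrightarrow> adj x y"
proof
  assume "tdist adj x y = 1"
  thus "adj x y" using tdist_path[of x y] by (metis relpowp_1)
next
  assume a: "adj x y"
  have "tdist adj x y \<le> 1" using tdist_le[of 1 x y] a by (metis relpowp_1)
  moreover have "tdist adj x y \<noteq> 0" using tdist_path[of x y] a adj_irrefl by (metis relpowp_0_E)
  ultimately show "tdist adj x y = 1" by simp
qed

lemma lev_orig [simp]: "lev orig = 0" by simp

lemma lev_adj_le: assumes "adj x y" shows "lev y \<le> Suc (lev x)"
  using tdist_path[of orig x] assms by (intro tdist_le) (auto intro: relpowp_Suc_I)

lemma exists_parent:
  assumes "x \<noteq> orig" shows "\<exists>y. adj y x \<and> Suc (lev y) = lev x"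
proof -
  obtain n where n: "lev x = Suc n" using assms by (metis lev_eq_0_iff not0_implies_Suc)
  then obtain y where y: "(adj ^^ n) orig y" "adj y x"
    using tdist_path[of orig x] by (auto elim: relpowp_Suc_E)
  have "lev y \<le> n" using y tdist_le by blast
  with lev_adj_le[OF y(2)] n y(2) show ?thesis by auto
qed

text \<open>Follow the paths to the root until they meet. The absence of cycles is used through this lemma: an edge within a
sphere, or two edges from one vertex to the preceding sphere, would close such a path to a cycle.\<close>

lemma path_below_sphere:
  assumes "lev x = n" "lev y = n" "x \<noteq> y"
  shows "\<exists>zs. zs \<noteq> [] \<and> distinct (x # zs @ [y]) \<and> successively adj (x # zs @ [y]) \<and>
    (\<forall>z\<in>set zs. lev z < n)"
  using assms
proof (induction n arbitrary: x y)
  case 0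
  hence "x = orig" "y = orig" by simp_all
  with 0 show ?case by simp
next
  case (Suc n)
  have "x \<noteq> orig" "y \<noteq> orig" using Suc.prems by auto
  then obtain a b where ab: "adj a x" "Suc (lev a) = lev x" "adj b y" "Suc (lev b) = lev y"
    using exists_parent[of x] exists_parent[of y] by blast
  show ?case
  proof (cases "a = b")
    case True
    have "lev a < Suc n" using ab(2) Suc.prems(1) by simp
    moreover from this have "distinct (x # [a] @ [y])" using Suc.prems by auto
    moreover have "successively adj (x # [a] @ [y])" using ab(3) True adj_sym[OF ab(1)] by simp
    ultimately show ?thesis by (intro exI[of _ "[a]"]) simp
  next
    case False
    then obtain zs where zs: "zs \<noteq> []" "distinct (a # zs @ [b])" "successively adj (a # zs @ [b])"
      "\<forall>z\<in>set zs. lev z < n"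
      using Suc.IH[of a b] ab(2,4) Suc.prems(1,2) by (metis Suc_inject)
    let ?zs = "a # zs @ [b]"
    have "lev a < Suc n" "lev b < Suc n" using ab(2,4) Suc.prems(1,2) by simp_all
    hence lev: "\<forall>z\<in>set ?zs. lev z < Suc n" using zs(4) by auto
    hence "x \<notin> set ?zs" "y \<notin> set ?zs" using Suc.prems by auto
    hence "distinct (x # ?zs @ [y])" using zs(2) Suc.prems(3) by auto
    moreover have "successively adj (?zs @ [y])"
      using zs(3) ab(3) by (subst successively_append_iff) simp
    hence "successively adj (x # ?zs @ [y])" using adj_sym[OF ab(1)] by simp
    ultimately show ?thesis using lev by (intro exI[of _ ?zs]) auto
  qed
qed

lemma lev_adj_neq: assumes "adj x y" shows "lev x \<noteq> lev y"
proof
  assume e: "lev x = lev y"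
  have "x \<noteq> y" using assms adj_irrefl by auto
  then obtain zs where "zs \<noteq> []" "distinct (x # zs @ [y])" "successively adj (x # zs @ [y])"
    using path_below_sphere[OF refl e[symmetric]] by auto
  hence "graph_cycle adj (x # zs @ [y])"
    using adj_sym[OF assms] unfolding graph_cycle_def by (simp add: Suc_le_eq)
  thus False using no_cycle by blast
qed

lemma parent_unique:
  assumes "adj x z" "adj y z" "Suc (lev x) = lev z" "Suc (lev y) = lev z"
  shows "x = y"
proof (rule ccontr)
  assume ne: "x \<noteq> y"
  have "lev y = lev x" using assms by simp
  then obtain zs where zs: "zs \<noteq> []" "distinct (x # zs @ [y])" "successively adj (x # zs @ [y])"
    "\<forall>w\<in>set zs. lev w < lev x" using path_below_sphere[OF refl _ ne] by blast
  have "z \<notin> set (x # zs @ [y])" using zs(4) assms adj_irrefl by auto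
  hence "graph_cycle adj (z # x # zs @ [y])"
    unfolding graph_cycle_def using zs(2,3) adj_sym[OF assms(1)] assms(2) by simp
  thus False using no_cycle by blast
qed

definition par :: "'v \<Rightarrow> 'v" where
  "par x = (THE y. adj y x \<and> Suc (lev y) = lev x)"

lemma par_eqI: "adj y x \<Longrightarrow> lev x = Suc (lev y) \<Longrightarrow> par x = y"
  unfolding par_def by (rule the_equality) (metis, metis parent_unique)

lemma adj_par: "x \<noteq> orig \<Longrightarrow> adj (par x) x"
  and lev_par: "x \<noteq> orig \<Longrightarrow> lev x = Suc (lev (par x))"
  using exists_parent[of x] by (auto simp: par_eqI)

definition children :: "'v \<Rightarrow> 'v set" where
  "children x = {y. y \<noteq> orig \<and> par y = x}"

lemma children_not_orig: "y \<in> children x \<Longrightarrow> y \<noteq> orig"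
  and children_par: "y \<in> children x \<Longrightarrow> par y = x"
  and children_lev: "y \<in> children x \<Longrightarrow> lev y = Suc (lev x)"
  using lev_par by (auto simp: children_def)

lemma children_alt: "children x = {y. adj x y \<and> lev y = Suc (lev x)}"
proof -
  have "y \<noteq> orig \<and> par y = x \<longleftrightarrow> adj x y \<and> lev y = Suc (lev x)" for y
    using adj_par[of y] lev_par[of y] par_eqI[of x y] by (cases "y = orig") auto
  thus ?thesis by (simp add: children_def)
qed

lemma neighbours_orig: "{y. adj orig y} = children orig"
proof -
  have "lev y = Suc 0" if "adj orig y" for y
    using lev_adj_le[OF that] lev_adj_neq[OF that] by (auto simp: le_Suc_eq)
  thus ?thesis by (auto simp: children_alt)
qed

lemma neighbours:
  assumes "x \<noteq> orig"
  shows "{y. adj x y} = insert (par x) (children x)" and "par x \<notin> children x"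
proof -
  have "y = par x \<or> y \<in> children x" if "adj x y" for y
  proof -
    have "lev y \<noteq> lev x" "lev y \<le> Suc (lev x)" "lev x \<le> Suc (lev y)"
      using lev_adj_neq[OF that] lev_adj_le[OF that] lev_adj_le[OF adj_sym[OF that]] by simp_all
    hence "lev y = Suc (lev x) \<or> lev x = Suc (lev y)" by linarith
    thus ?thesis using that par_eqI[OF adj_sym[OF that]] by (auto simp: children_alt)
  qed
  thus "{y. adj x y} = insert (par x) (children x)"
    using adj_sym[OF adj_par[OF assms]] by (auto simp: children_alt)
  show "par x \<notin> children x" using children_lev[of "par x" x] lev_par[OF assms] by auto
qed

lemma finite_neighbours: "finite {y. adj x y}"
  using card_neighbours[of x] by (intro card_ge_0_finite) simp

lemma finite_children [simp]: "finite (children x)"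
  by (rule finite_subset[OF _ finite_neighbours[of x]]) (auto simp: children_alt)

lemma card_children_orig: "card (children orig) = q + 1"
  using neighbours_orig card_neighbours by metis

lemma card_children: "x \<noteq> orig \<Longrightarrow> card (children x) = q"
  using neighbours[of x] card_neighbours[of x] by simp

lemma card_children_le: "card (children x) \<le> q + 1"
  by (cases "x = orig") (auto simp: card_children_orig card_children)

definition tsphere :: "nat \<Rightarrow> 'v set" where "tsphere n = {x. lev x = n}"

lemma tsphere_0: "tsphere 0 = {orig}" by (auto simp: tsphere_def)

lemma tsphere_Suc: "tsphere (Suc n) = (\<Union>x\<in>tsphere n. children x)"
proof -
  have "lev x = Suc n \<longleftrightarrow> x \<noteq> orig \<and> lev (par x) = n" for x
    using lev_par[of x] by (cases "x = orig") auto
  thus ?thesis by (simp add: tsphere_def children_def) blast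
qed

lemma finite_tsphere [simp]: "finite (tsphere n)"
proof (induction n)
  case (Suc n)
  thus ?case unfolding tsphere_Suc by (intro finite_UN_I finite_children)
qed (simp add: tsphere_0)

lemma sum_tsphere_Suc:
  "(\<Sum>x\<in>tsphere (Suc n). f x) = (\<Sum>x\<in>tsphere n. \<Sum>y\<in>children x. f y)"
  unfolding tsphere_Suc by (rule sum.UNION_disjoint) (auto dest: children_par)

text \<open>The level is prescribed because \<open>par orig\<close> is an unspecified vertex.\<close>

definition desc :: "nat \<Rightarrow> 'v \<Rightarrow> 'v set" where
  "desc k y = {x. lev x = lev y + k \<and> (par ^^ k) x = y}"

lemma desc_0 [simp]: "desc 0 y = {y}" by (auto simp: desc_def)

lemma desc_Suc: "desc (Suc k) y = (\<Union>x\<in>desc k y. children x)"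
proof -
  have "(par ^^ Suc k) x = (par ^^ k) (par x)" for x by (simp add: funpow_swap1)
  moreover have "lev x = lev y + Suc k \<longleftrightarrow> x \<noteq> orig \<and> lev (par x) = lev y + k" for x
    using lev_par[of x] by (cases "x = orig") auto
  ultimately show ?thesis unfolding desc_def children_def by auto
qed

lemma finite_desc [simp]: "finite (desc k y)"
proof (induction k)
  case (Suc k)
  thus ?case unfolding desc_Suc by (intro finite_UN_I finite_children)
qed simp

lemma desc_not_orig: "y \<noteq> orig \<Longrightarrow> x \<in> desc k y \<Longrightarrow> x \<noteq> orig"
  by (auto simp: desc_def simp flip: lev_eq_0_iff)

lemma sum_desc_Suc: "(\<Sum>x\<in>desc (Suc k) y. f x) = (\<Sum>x\<in>desc k y. \<Sum>z\<in>children x. f z)"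
  unfolding desc_Suc by (rule sum.UNION_disjoint) (auto dest: children_par)

lemma card_desc: "y \<noteq> orig \<Longrightarrow> card (desc k y) = q ^ k"
proof (induction k)
  case (Suc k)
  have "card (desc (Suc k) y) = (\<Sum>x\<in>desc k y. card (children x))"
    using sum_desc_Suc[of "\<lambda>_. 1 :: nat" k y] by simp
  also have "\<dots> = (\<Sum>x\<in>desc k y. q)"
    using desc_not_orig[OF Suc.prems] by (intro sum.cong) (auto simp: card_children)
  finally show ?case using Suc by simp
qed simp

lemma desc_disjoint:
  "y \<in> tsphere n \<Longrightarrow> y' \<in> tsphere n \<Longrightarrow> y \<noteq> y' \<Longrightarrow> desc k y \<inter> desc k' y' = {}"
  by (auto simp: desc_def tsphere_def)

subsection \<open>Geodesics from the root\<close>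

lemma geodesic_lev: "successively adj xs \<Longrightarrow> xs \<noteq> [] \<Longrightarrow> hd xs = orig \<Longrightarrow>
   lev (last xs) < length xs"
proof (induction xs rule: rev_induct)
  case (snoc x xs)
  show ?case
  proof (cases "xs = []")
    case False
    hence "lev (last xs) < length xs" "adj (last xs) x"
      using snoc by (auto simp: successively_append_iff)
    thus ?thesis using lev_adj_le[of "last xs" x] by simp
  qed (use snoc in auto)
qed simp

lemma is_geodesic_orig: "is_geodesic adj orig orig xs \<longleftrightarrow> xs = [orig]"
  unfolding is_geodesic_def by (cases xs) auto

text \<open>Geodesics from the root follow the parents. Hence the horocyclic index, which is defined by
\<open>geodesic_path\<close>, can be computed by recursion along parents.\<close>

lemma is_geodesic_snoc:
  assumes "x \<noteq> orig"
  shows "is_geodesic adj orig x xs \<longleftrightarrow> (\<exists>ys. xs = ys @ [x] \<and> is_geodesic adj orig (par x) ys)"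
proof
  assume g: "is_geodesic adj orig x xs"
  hence ne: "xs \<noteq> []" and len: "length xs = Suc (lev x)" by (auto simp: is_geodesic_def)
  define ys where "ys = butlast xs"
  have xs: "xs = ys @ [x]" using g ne by (auto simp: ys_def is_geodesic_def)
  have ys: "ys \<noteq> []" using len assms by (auto simp: xs simp flip: lev_eq_0_iff)
  have s: "successively adj ys" "adj (last ys) x" "hd ys = orig"
    using g ys unfolding is_geodesic_def xs by (simp_all add: successively_append_iff)
  have "lev (last ys) < length ys" using geodesic_lev s ys by blast
  hence "lev x = Suc (lev (last ys))" using lev_adj_le[OF s(2)] len xs by auto
  hence "last ys = par x" using par_eqI[OF s(2)] by auto
  thus "\<exists>ys. xs = ys @ [x] \<and> is_geodesic adj orig (par x) ys"
    using xs s len lev_par[OF assms] by (auto simp: is_geodesic_def)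
next
  assume "\<exists>ys. xs = ys @ [x] \<and> is_geodesic adj orig (par x) ys"
  then obtain ys where ys: "xs = ys @ [x]" "is_geodesic adj orig (par x) ys" by blast
  moreover from ys have "ys \<noteq> []" by (auto simp: is_geodesic_def)
  ultimately show "is_geodesic adj orig x xs"
    using adj_par[OF assms] lev_par[OF assms]
    by (auto simp: is_geodesic_def successively_append_iff)
qed

lemma geodesic_unique: "\<exists>!xs. is_geodesic adj orig x xs"
proof (induction "lev x" arbitrary: x)
  case 0
  hence "x = orig" by simp
  thus ?case using is_geodesic_orig by simp
next
  case (Suc n)
  hence x: "x \<noteq> orig" by auto
  have "n = lev (par x)" using Suc.hyps(2) lev_par[OF x] by simp
  from Suc.hyps(1)[OF this] show ?case unfolding is_geodesic_snoc[OF x] by blast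
qed

lemma geodesic_path_orig: "geodesic_path adj orig orig = [orig]"
  unfolding geodesic_path_def is_geodesic_orig by (rule the_eq_trivial)

lemma geodesic_path_snoc:
  assumes "x \<noteq> orig"
  shows "geodesic_path adj orig x = geodesic_path adj orig (par x) @ [x]"
proof -
  have "is_geodesic adj orig (par x) (geodesic_path adj orig (par x))"
    unfolding geodesic_path_def using geodesic_unique by (rule theI')
  hence "is_geodesic adj orig x (geodesic_path adj orig (par x) @ [x])"
    using is_geodesic_snoc[OF assms] by blast
  thus ?thesis unfolding geodesic_path_def[of adj orig x]
    using geodesic_unique[of x] by (intro the1_equality)
qed

subsection \<open>Rays, cylinders and the horocyclic index\<close>

abbreviation "\<Omega> \<equiv> boundary adj orig"
abbreviation "cyl \<equiv> boundary_cyl adj orig"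

lemma boundary_tdist: "\<omega> \<in> \<Omega> \<Longrightarrow> m \<le> n \<Longrightarrow> tdist adj (\<omega> m) (\<omega> n) = n - m"
  by (simp add: boundary_def)

lemma boundary_lev: "\<omega> \<in> \<Omega> \<Longrightarrow> lev (\<omega> n) = n"
  using boundary_tdist[of \<omega> 0 n] by (simp add: boundary_def)

lemma boundary_adj: "\<omega> \<in> \<Omega> \<Longrightarrow> adj (\<omega> n) (\<omega> (Suc n))"
  using boundary_tdist[of \<omega> n "Suc n"] tdist_eq_1_iff[of "\<omega> n" "\<omega> (Suc n)"] by simp

lemma boundary_par: "\<omega> \<in> \<Omega> \<Longrightarrow> par (\<omega> (Suc n)) = \<omega> n"
  by (rule par_eqI) (simp_all add: boundary_lev boundary_adj)

lemma cyl_iff: "\<omega> \<in> cyl x \<longleftrightarrow> \<omega> \<in> \<Omega> \<and> \<omega> (lev x) = x"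
  by (auto simp: boundary_cyl_def)

lemma cyl_orig: "cyl orig = \<Omega>"
proof -
  have "\<omega> 0 = orig" if "\<omega> \<in> \<Omega>" for \<omega> using that by (simp add: boundary_def)
  thus ?thesis unfolding boundary_cyl_def lev_orig by blast
qed

lemma cyl_subset: "cyl x \<subseteq> \<Omega>" by (auto simp: cyl_iff)

lemma cyl_children: "cyl x = (\<Union>y\<in>children x. cyl y)"
proof (intro equalityI subsetI)
  fix \<omega> assume w: "\<omega> \<in> cyl x"
  let ?y = "\<omega> (Suc (lev x))"
  have "?y \<in> children x"
    using w boundary_adj[of \<omega> "lev x"] boundary_lev[of \<omega>] by (simp add: cyl_iff children_alt)
  moreover have "\<omega> \<in> cyl ?y" using w boundary_lev[of \<omega> "Suc (lev x)"] by (simp add: cyl_iff)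
  ultimately show "\<omega> \<in> (\<Union>y\<in>children x. cyl y)" by blast
next
  fix \<omega> assume "\<omega> \<in> (\<Union>y\<in>children x. cyl y)"
  then obtain y where y: "y \<in> children x" "\<omega> \<in> cyl y" by auto
  have "\<omega> \<in> \<Omega>" "\<omega> (Suc (lev x)) = y" using y(2) children_lev[OF y(1)] by (simp_all add: cyl_iff)
  thus "\<omega> \<in> cyl x"
    using boundary_par[of \<omega> "lev x"] children_par[OF y(1)] unfolding cyl_iff by metis
qed

lemma cyl_disjoint: "lev x = lev y \<Longrightarrow> x \<noteq> y \<Longrightarrow> cyl x \<inter> cyl y = {}"
  by (metis (no_types) cyl_iff disjoint_iff)

lemma cyl_par: "x \<noteq> orig \<Longrightarrow> cyl x \<subseteq> cyl (par x)"
  unfolding cyl_children[of "par x"] by (rule UN_upper) (simp add: children_def)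

lemma range_iff:
  assumes w: "\<omega> \<in> \<Omega>" shows "x \<in> range \<omega> \<longleftrightarrow> \<omega> \<in> cyl x"
proof
  assume "x \<in> range \<omega>"
  then obtain n where n: "x = \<omega> n" by (rule rangeE)
  have "lev x = n" unfolding n by (rule boundary_lev[OF w])
  thus "\<omega> \<in> cyl x" unfolding cyl_iff using w n by simp
next
  assume "\<omega> \<in> cyl x"
  hence "x = \<omega> (lev x)" unfolding cyl_iff by (rule conjE) (rule sym)
  thus "x \<in> range \<omega>" by (rule range_eqI)
qed

abbreviation hor :: "(nat \<Rightarrow> 'v) \<Rightarrow> 'v \<Rightarrow> int" where "hor \<equiv> horo adj orig"

lemma hor_orig: "\<omega> \<in> \<Omega> \<Longrightarrow> hor \<omega> orig = 0"
proof -
  assume "\<omega> \<in> \<Omega>"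
  hence "orig \<in> range \<omega>" using range_iff cyl_orig by blast
  thus ?thesis by (simp add: horo_def confluent_def geodesic_path_orig)
qed

lemma hor_cyl: "\<omega> \<in> cyl x \<Longrightarrow> hor \<omega> x = int (lev x)"
proof -
  assume w: "\<omega> \<in> cyl x"
  hence "\<omega> \<in> \<Omega>" using cyl_subset by auto
  with w have "x \<in> range \<omega>" using range_iff by blast
  moreover have "\<exists>xs. geodesic_path adj orig x = xs @ [x]"
    by (cases "x = orig") (simp_all add: geodesic_path_orig geodesic_path_snoc[of x])
  then obtain xs where "geodesic_path adj orig x = xs @ [x]" by blast
  ultimately have "confluent adj orig x \<omega> = x" by (simp add: confluent_def)
  thus ?thesis by (simp add: horo_def)
qed

text \<open>Off the cylinder of \<open>x\<close>, the vertices \<open>x\<close> and \<open>par x\<close> have the same confluence point, and only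
the level changes.\<close>

lemma hor_not_cyl:
  assumes "\<omega> \<in> \<Omega>" "\<omega> \<notin> cyl x" shows "hor \<omega> x = hor \<omega> (par x) - 1"
proof -
  have "x \<noteq> orig" using assms cyl_orig by auto
  moreover have "x \<notin> range \<omega>" using assms range_iff by blast
  ultimately have "confluent adj orig x \<omega> = confluent adj orig (par x) \<omega>"
    by (simp add: confluent_def geodesic_path_snoc)
  thus ?thesis using lev_par[OF \<open>x \<noteq> orig\<close>] by (simp add: horo_def)
qed

end

section \<open>Weak type bounds and averages over descendants\<close>

lemma power_bracket:
  fixes b R :: real assumes "1 < b" "1 < R"
  shows "\<exists>k. b ^ k < R \<and> R \<le> b ^ Suc k"
proof -
  obtain m where "R < b ^ m" using real_arch_pow[OF assms(1)] by blast
  define n where "n = (LEAST n. R \<le> b ^ n)"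
  have n: "R \<le> b ^ n"
    using LeastI[of "\<lambda>n. R \<le> b ^ n" m] \<open>R < b ^ m\<close> unfolding n_def by simp
  have "n \<noteq> 0" using n assms by (cases n) auto
  then obtain k where k: "n = Suc k" using not0_implies_Suc by blast
  have "\<not> R \<le> b ^ k" using not_less_Least[of k "\<lambda>n. R \<le> b ^ n"] k by (simp add: n_def)
  thus ?thesis using n k by (intro exI[of _ k]) auto
qed

text \<open>A geometric sum is comparable to its largest term.\<close>

lemma sum_powers_below:
  fixes b Y :: real assumes "1 < b" "0 \<le> Y"
  shows "(\<Sum>n<N. if b ^ n < Y then b ^ n else 0) \<le> b / (b - 1) * Y"
proof (induction N)
  case 0
  show ?case using assms by simp
next
  case (Suc N)
  show ?case
  proof (cases "b ^ N < Y")
    case True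
    have "(\<Sum>n<Suc N. if b ^ n < Y then b ^ n else 0) \<le> (\<Sum>n<Suc N. b ^ n)"
      using assms by (intro sum_mono) auto
    also have "\<dots> = (b ^ Suc N - 1) / (b - 1)" using assms by (intro geometric_sum) simp
    also have "\<dots> \<le> (b * Y) / (b - 1)"
      using assms True by (intro divide_right_mono) (auto intro: order_trans[of _ "b * b ^ N"])
    finally show ?thesis by simp
  qed (use Suc in simp)
qed

text \<open>The quasi-norm of weak $L^r$ is at most $B^{1/r}$, in the form of a bound for the distribution function.\<close>

definition weak_bound :: "real \<Rightarrow> real \<Rightarrow> ('a \<Rightarrow> complex) \<Rightarrow> bool" where
  "weak_bound r B u \<longleftrightarrow>
     (\<forall>t>0. finite {x. t < norm (u x)} \<and> real (card {x. t < norm (u x)}) \<le> B * t powr (-r))"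

lemma weak_boundD:
  assumes "weak_bound r B u" "0 < t"
  shows "finite {x. t < norm (u x)}" "real (card {x. t < norm (u x)}) \<le> B * t powr (-r)"
  using assms unfolding weak_bound_def by blast+

lemma weak_Lp_norm_le_iff:
  assumes r: "0 < r" and A: "0 \<le> A"
  shows "weak_Lp_norm r u \<le> ennreal A \<longleftrightarrow> weak_bound r (A powr r) u"
proof -
  have *: "t * c powr (1 / r) \<le> A \<longleftrightarrow> c \<le> A powr r * t powr (-r)" if "0 < t" "0 \<le> c" for t c :: real
  proof -
    have "t * c powr (1 / r) \<le> A \<longleftrightarrow> c powr (1 / r) \<le> A / t"
      using that by (simp add: field_simps)
    also have "\<dots> \<longleftrightarrow> (c powr (1 / r)) powr r \<le> (A / t) powr r"
    proof
      assume "c powr (1 / r) \<le> A / t"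
      thus "(c powr (1 / r)) powr r \<le> (A / t) powr r" using r by (intro powr_mono2) auto
    next
      assume "(c powr (1 / r)) powr r \<le> (A / t) powr r"
      thus "c powr (1 / r) \<le> A / t"
        using powr_less_mono2[of r "A / t" "c powr (1 / r)"] r A that by (meson divide_nonneg_pos not_le)
    qed
    also have "(c powr (1 / r)) powr r = c" using that r by (simp add: powr_powr)
    also have "(A / t) powr r = A powr r * t powr (-r)"
      using that A by (simp add: powr_divide powr_minus_divide)
    finally show ?thesis .
  qed
  show ?thesis
    unfolding weak_Lp_norm_def weak_bound_def SUP_le_iff
    using * A by (auto simp: ennreal_le_iff top_unique)
qed

text \<open>Decompose the sum into the ranges $2^k t < |f(x)| \le 2^{k+1} t$; the bounds for these ranges form
a convergent geometric series because $r > 1$.\<close>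

lemma weak_bound_tail_sum:
  assumes r: "1 < r" and W: "weak_bound r B f" and t: "0 < t"
  shows "(\<Sum>x\<in>{x. t < norm (f x)}. norm (f x)) \<le> 2 / (1 - 2 powr (1 - r)) * B * t powr (1 - r)"
proof -
  define S where "S = {x. t < norm (f x)}"
  have fin: "finite S" using weak_boundD(1)[OF W t] by (simp add: S_def)
  have B: "0 \<le> B"
  proof -
    have "0 \<le> B * t powr (-r)" using weak_boundD(2)[OF W t] by linarith
    thus ?thesis using t by (simp add: zero_le_mult_iff)
  qed
  have "\<exists>K. \<forall>x\<in>S. \<exists>k<K. 2 ^ k * t < norm (f x) \<and> norm (f x) \<le> 2 ^ Suc k * t"
  proof -
    have "\<exists>k. 2 ^ k * t < norm (f x) \<and> norm (f x) \<le> 2 ^ Suc k * t" if "x \<in> S" for x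
      using power_bracket[of 2 "norm (f x) / t"] that t by (simp add: S_def field_simps)
    then obtain k where k: "\<And>x. x \<in> S \<Longrightarrow> 2 ^ k x * t < norm (f x) \<and> norm (f x) \<le> 2 ^ Suc (k x) * t"
      by metis
    obtain K where "\<forall>n\<in>k ` S. n < K" using fin finite_nat_set_iff_bounded[of "k ` S"] by auto
    thus ?thesis using k by (intro exI[of _ K]) auto
  qed
  then obtain K where K: "\<And>x. x \<in> S \<Longrightarrow> \<exists>k<K. 2 ^ k * t < norm (f x) \<and> norm (f x) \<le> 2 ^ Suc k * t"
    by blast
  have "(\<Sum>x\<in>S. norm (f x)) \<le> (\<Sum>x\<in>S. \<Sum>k<K. if 2 ^ k * t < norm (f x) then 2 ^ Suc k * t else 0)"
  proof (intro sum_mono)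
    fix x assume "x \<in> S"
    then obtain k where k: "k < K" "2 ^ k * t < norm (f x)" "norm (f x) \<le> 2 ^ Suc k * t"
      using K by blast
    have "norm (f x) \<le> (if 2 ^ k * t < norm (f x) then 2 ^ Suc k * t else 0)" using k by simp
    also have "\<dots> \<le> (\<Sum>k<K. if 2 ^ k * t < norm (f x) then 2 ^ Suc k * t else 0)"
      using k t by (intro member_le_sum) auto
    finally show "norm (f x) \<le> (\<Sum>k<K. if 2 ^ k * t < norm (f x) then 2 ^ Suc k * t else 0)" .
  qed
  also have "\<dots> = (\<Sum>k<K. \<Sum>x\<in>S. if 2 ^ k * t < norm (f x) then 2 ^ Suc k * t else 0)"
    by (rule sum.swap)
  also have "\<dots> \<le> (\<Sum>k<K. 2 * B * t powr (1 - r) * (2 powr (1 - r)) ^ k)"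
  proof (intro sum_mono)
    fix k
    have pos: "0 < 2 ^ k * t" using t by simp
    have "(\<Sum>x\<in>S. if 2 ^ k * t < norm (f x) then 2 ^ Suc k * t else 0)
        = 2 ^ Suc k * t * real (card (S \<inter> {x. 2 ^ k * t < norm (f x)}))"
      using fin by (simp add: sum.If_cases)
    also have "\<dots> \<le> 2 ^ Suc k * t * real (card {x. 2 ^ k * t < norm (f x)})"
      using weak_boundD(1)[OF W pos] t by (intro mult_left_mono of_nat_mono card_mono) auto
    also have "\<dots> \<le> 2 ^ Suc k * t * (B * (2 ^ k * t) powr (-r))"
      using weak_boundD(2)[OF W pos] t by (intro mult_left_mono) auto
    also have "\<dots> = 2 * B * ((2 ^ k * t) powr 1 * (2 ^ k * t) powr (-r))"
      using pos by simp
    also have "\<dots> = 2 * B * (2 ^ k * t) powr (1 - r)"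
      by (simp only: powr_add[symmetric]) simp
    also have "\<dots> = 2 * B * t powr (1 - r) * (2 powr (1 - r)) ^ k"
      using t by (simp add: powr_mult powr_realpow[symmetric] powr_powr mult.commute)
    finally show "(\<Sum>x\<in>S. if 2 ^ k * t < norm (f x) then 2 ^ Suc k * t else 0)
      \<le> 2 * B * t powr (1 - r) * (2 powr (1 - r)) ^ k" .
  qed
  also have "\<dots> = 2 * B * t powr (1 - r) * (\<Sum>k<K. (2 powr (1 - r)) ^ k)"
    by (simp add: sum_distrib_left)
  also have "\<dots> \<le> 2 * B * t powr (1 - r) * (1 / (1 - 2 powr (1 - r)))"
  proof (intro mult_left_mono)
    have "2 powr (1 - r) < 2 powr (0::real)" using r by (intro powr_less_mono) auto
    hence a: "norm (2 powr (1 - r)) < 1" by simp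
    show "(\<Sum>k<K. (2 powr (1 - r)) ^ k) \<le> 1 / (1 - 2 powr (1 - r))"
      unfolding suminf_geometric[OF a, symmetric]
      by (intro sum_le_suminf summable_geometric a) auto
  qed (use B in simp)
  finally show ?thesis by (simp add: S_def)
qed

lemma norm_nat_powr: "norm (of_nat q powr s :: complex) = real q powr Re s"
  using norm_powr_real_powr[of "of_nat q" s] by simp

lemma power_powr: "0 < x \<Longrightarrow> (x ^ k) powr a = (x powr a) ^ k" for x a :: real
  by (induction k) (simp_all add: powr_mult)

context rooted_tree begin

text \<open>The value at the root is chosen so that it does not affect weak type bounds.\<close>

definition slope :: "complex \<Rightarrow> ('v \<Rightarrow> complex) \<Rightarrow> 'v \<Rightarrow> complex" where
  "slope s u x = (if x = orig then 0 else u x - of_nat q powr (-s) * u (par x))"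

text \<open>If the slope at \<open>x\<close> exceeds $t$, then $|u| > t/2$ at \<open>x\<close> or at its parent, and every vertex is
the parent of at most $q+1$ vertices.\<close>

lemma weak_bound_slope:
  assumes W: "weak_bound r B u" and s: "0 \<le> Re s"
  shows "weak_bound r ((real q + 2) * 2 powr r * B) (slope s u)"
  unfolding weak_bound_def
proof (intro allI impI)
  fix t :: real assume t: "0 < t"
  let ?U = "{x. t / 2 < norm (u x)}" and ?D = "{x. t < norm (slope s u x)}"
  have U: "finite ?U" "real (card ?U) \<le> B * (t / 2) powr (-r)"
    using weak_boundD[OF W, of "t / 2"] t by auto
  have sub: "?D \<subseteq> ?U \<union> (\<Union>w\<in>?U. children w)"
  proof
    fix x assume "x \<in> ?D"
    hence x: "t < norm (slope s u x)" by simp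
    have "x \<noteq> orig" using x t unfolding slope_def by (cases "x = orig") simp_all
    hence "t < norm (u x - of_nat q powr (-s) * u (par x))" using x unfolding slope_def by simp
    also have "\<dots> \<le> norm (u x) + real q powr (- Re s) * norm (u (par x))"
      using norm_triangle_ineq4[of "u x" "of_nat q powr (-s) * u (par x)"]
      by (simp add: norm_mult norm_nat_powr)
    also have "real q powr (- Re s) * norm (u (par x)) \<le> 1 * norm (u (par x))"
      using s q_ge_2 powr_mono[of "- Re s" 0 "real q"] by (intro mult_right_mono) simp_all
    finally have "t / 2 < norm (u x) \<or> t / 2 < norm (u (par x))" by linarith
    moreover have "x \<in> children (par x)" using \<open>x \<noteq> orig\<close> by (simp add: children_def)
    ultimately show "x \<in> ?U \<union> (\<Union>w\<in>?U. children w)" by blast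
  qed
  have fin: "finite (?U \<union> (\<Union>w\<in>?U. children w))"
    using U(1) by (intro finite_UnI finite_UN_I finite_children)
  have "card ?D \<le> card (?U \<union> (\<Union>w\<in>?U. children w))" using fin sub by (rule card_mono)
  also have "\<dots> \<le> card ?U + card (\<Union>w\<in>?U. children w)" by (rule card_Un_le)
  also have "card (\<Union>w\<in>?U. children w) \<le> (\<Sum>w\<in>?U. card (children w))"
    using U(1) by (rule card_UN_le)
  also have "\<dots> \<le> (\<Sum>w\<in>?U. q + 1)" by (intro sum_mono card_children_le)
  finally have "card ?D \<le> (q + 2) * card ?U" by (simp add: algebra_simps)
  hence "real (card ?D) \<le> (real q + 2) * real (card ?U)"
    unfolding of_nat_le_iff[where 'a = real, symmetric] by (simp add: algebra_simps)
  also have "\<dots> \<le> (real q + 2) * (B * (t / 2) powr (-r))"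
    using U(2) by (intro mult_left_mono) auto
  also have "(t / 2) powr (-r) = 2 powr r * t powr (-r)"
    using t by (simp add: powr_divide powr_minus divide_simps)
  finally show "finite ?D \<and> real (card ?D) \<le> (real q + 2) * 2 powr r * B * t powr (-r)"
    using finite_subset[OF sub fin] by (simp add: mult_ac)
qed

lemma sum_desc_multiplicative:
  assumes add: "\<And>y. y \<noteq> orig \<Longrightarrow> (\<Sum>z\<in>children y. d z) = c * d y" and y: "y \<noteq> orig"
  shows "(\<Sum>x\<in>desc k y. d x) = c ^ k * (d y :: complex)"
proof (induction k)
  case (Suc k)
  have "(\<Sum>x\<in>desc (Suc k) y. d x) = (\<Sum>x\<in>desc k y. c * d x)"
    unfolding sum_desc_Suc using desc_not_orig[OF y] by (intro sum.cong add) auto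
  thus ?case using Suc by (simp add: sum_distrib_left[symmetric])
qed simp

text \<open>The step from weak to strong type. For each \<open>y\<close> on the sphere, the $q^k$ descendants of generation
$k$ carry the sum $q^{sk} d(y)$, so at $q^k \approx (|d(y)|/t)^r$ the values of $d$ on this block have
an average size of about $t$. Thus a fixed part of the sum over the block comes from points
with $|d| > t/2$. Blocks of different \<open>y\<close> are disjoint even if the generations differ, so
\<open>weak_bound_tail_sum\<close> bounds the total number of points in the blocks,
which is comparable to $t^{-r} \sum_y |d(y)|^r$.\<close>

lemma tsphere_sum_le_weak_bound:
  assumes r: "1 < r" and s: "Re s = 1 - 1 / r" and W: "weak_bound r B d"
    and add: "\<And>y. y \<noteq> orig \<Longrightarrow> (\<Sum>z\<in>children y. d z) = of_nat q powr s * d y" and n: "n \<noteq> 0"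
  shows "(\<Sum>y\<in>tsphere n. norm (d y) powr r) \<le> real q * 2 powr r * (2 / (1 - 2 powr (1 - r))) * B"
proof -
  define Y where "Y = {y \<in> tsphere n. d y \<noteq> 0}"
  have finY: "finite Y" by (simp add: Y_def)
  have Y_orig: "y \<noteq> orig" if "y \<in> Y" for y
  proof -
    have "lev y = n" using that by (simp add: Y_def tsphere_def)
    thus ?thesis using n by (metis lev_orig)
  qed
  \<comment> \<open>Every nonzero value on the sphere has to exceed \<open>t\<close>; the \<open>1\<close> covers the case that there is none.\<close>
  define t where "t = Min (insert 1 ((\<lambda>y. norm (d y)) ` Y)) / 2"
  have t0: "0 < t" unfolding t_def using finY by (auto simp: Y_def)
  have t: "t < norm (d y)" if "y \<in> Y" for y
  proof -
    have "2 * t \<le> norm (d y)" unfolding t_def using finY that by (auto intro: Min_le)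
    thus ?thesis using t0 by linarith
  qed
  have q1: "1 < real q" using q_ge_2 by simp
  have "\<forall>y\<in>Y. \<exists>k. real q ^ k < (norm (d y) / t) powr r \<and> (norm (d y) / t) powr r \<le> real q ^ Suc k"
  proof (intro ballI power_bracket[OF q1])
    fix y assume "y \<in> Y"
    hence "1 powr r < (norm (d y) / t) powr r"
      using t[of y] t0 r by (intro powr_less_mono2) auto
    thus "1 < (norm (d y) / t) powr r" by simp
  qed
  from bchoice[OF this] obtain k where "\<forall>y\<in>Y. real q ^ k y < (norm (d y) / t) powr r \<and>
      (norm (d y) / t) powr r \<le> real q ^ Suc (k y)" ..
  hence k: "\<And>y. y \<in> Y \<Longrightarrow> real q ^ k y < (norm (d y) / t) powr r"
    "\<And>y. y \<in> Y \<Longrightarrow> (norm (d y) / t) powr r \<le> real q ^ Suc (k y)"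
    by blast+
  \<comment> \<open>Outside \<open>T\<close>, a block contributes at most half of its sum.\<close>
  define T where "T = {x. t / 2 < norm (d x)}"
  have finT: "finite T" using weak_boundD(1)[OF W, of "t / 2"] t0 by (simp add: T_def)
  have block: "t / 2 * real q ^ k y \<le> (\<Sum>x\<in>desc (k y) y \<inter> T. norm (d x))" if y: "y \<in> Y" for y
  proof -
    let ?D = "desc (k y) y"
    have card: "real (card ?D) = real q ^ k y" using card_desc[OF Y_orig[OF y]] by simp
    have "(real q ^ k y) powr (1 / r) \<le> ((norm (d y) / t) powr r) powr (1 / r)"
      using k(1)[OF y] r by (intro powr_mono2) auto
    also have "\<dots> = norm (d y) / t" using r t0 by (simp add: powr_powr)
    finally have "t * (real q ^ k y) powr (1 / r) \<le> norm (d y)" using t0 by (simp add: field_simps)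
    hence "(real q ^ k y) powr Re s * (t * (real q ^ k y) powr (1 / r))
        \<le> (real q ^ k y) powr Re s * norm (d y)"
      by (intro mult_left_mono) auto
    also have "(real q ^ k y) powr Re s * (t * (real q ^ k y) powr (1 / r))
        = t * (real q ^ k y) powr (Re s + 1 / r)"
      by (simp add: powr_add)
    also have "\<dots> = t * real q ^ k y" using q1 by (simp add: s)
    also have "(real q ^ k y) powr Re s * norm (d y) = norm (\<Sum>x\<in>?D. d x)"
    proof -
      have "(\<Sum>x\<in>?D. d x) = (of_nat q powr s) ^ k y * d y"
        by (rule sum_desc_multiplicative[OF _ Y_orig[OF y]]) (rule add)
      thus ?thesis
        using power_powr[of "real q" "k y" "Re s"] q1 by (simp add: norm_mult norm_power norm_nat_powr)
    qed
    also have "\<dots> \<le> (\<Sum>x\<in>?D. norm (d x))" by (rule norm_sum)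
    also have "\<dots> = (\<Sum>x\<in>?D \<inter> T. norm (d x)) + (\<Sum>x\<in>?D - T. norm (d x))"
      by (simp add: sum.Int_Diff)
    also have "(\<Sum>x\<in>?D - T. norm (d x)) \<le> (\<Sum>x\<in>?D - T. t / 2)"
      by (intro sum_mono) (auto simp: T_def)
    also have "\<dots> \<le> (\<Sum>x\<in>?D. t / 2)" using t0 by (intro sum_mono2) auto
    also have "\<dots> = t / 2 * real q ^ k y" using card by simp
    finally show ?thesis by simp
  qed
  have "(\<Sum>y\<in>Y. t / 2 * real q ^ k y) \<le> (\<Sum>y\<in>Y. \<Sum>x\<in>desc (k y) y \<inter> T. norm (d x))"
    by (intro sum_mono block)
  also have "\<dots> = (\<Sum>x\<in>(\<Union>y\<in>Y. desc (k y) y \<inter> T). norm (d x))"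
  proof (rule sum.UNION_disjoint[symmetric])
    show "\<forall>i\<in>Y. \<forall>j\<in>Y. i \<noteq> j \<longrightarrow> (desc (k i) i \<inter> T) \<inter> (desc (k j) j \<inter> T) = {}"
      using desc_disjoint[where n = n] unfolding Y_def by blast
  qed (use finY in auto)
  also have "\<dots> \<le> (\<Sum>x\<in>T. norm (d x))" using finT by (intro sum_mono2) auto
  also have "\<dots> \<le> 2 / (1 - 2 powr (1 - r)) * B * (t / 2) powr (1 - r)"
    unfolding T_def using t0 by (intro weak_bound_tail_sum r W) simp
  finally have sumk: "(\<Sum>y\<in>Y. t / 2 * real q ^ k y) \<le> 2 / (1 - 2 powr (1 - r)) * B * (t / 2) powr (1 - r)" .
  have "(\<Sum>y\<in>tsphere n. norm (d y) powr r) = (\<Sum>y\<in>Y. norm (d y) powr r)"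
    by (rule sum.mono_neutral_right) (auto simp: Y_def)
  also have "\<dots> \<le> (\<Sum>y\<in>Y. 2 * real q * t powr (r - 1) * (t / 2 * real q ^ k y))"
  proof (intro sum_mono)
    fix y assume y: "y \<in> Y"
    have "norm (d y) powr r = t powr r * (norm (d y) / t) powr r"
      using t0 by (simp add: powr_divide)
    also have "\<dots> \<le> t powr r * real q ^ Suc (k y)" using k(2)[OF y] by (intro mult_left_mono) auto
    also have "t powr r = t powr (r - 1) * t" using t0 powr_add[of t "r - 1" 1] by simp
    finally show "norm (d y) powr r \<le> 2 * real q * t powr (r - 1) * (t / 2 * real q ^ k y)"
      by (simp add: mult_ac)
  qed
  also have "\<dots> = 2 * real q * t powr (r - 1) * (\<Sum>y\<in>Y. t / 2 * real q ^ k y)"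
    by (simp add: sum_distrib_left)
  also have "\<dots> \<le> 2 * real q * t powr (r - 1) * (2 / (1 - 2 powr (1 - r)) * B * (t / 2) powr (1 - r))"
    by (intro mult_left_mono sumk) auto
  also have "\<dots> = real q * (2 * (t powr (r - 1) * (t / 2) powr (1 - r))) * (2 / (1 - 2 powr (1 - r))) * B"
    by (simp only: mult_ac)
  also have "2 * (t powr (r - 1) * (t / 2) powr (1 - r)) = 2 powr r"
  proof -
    have "t powr (r - 1) * (t / 2) powr (1 - r) = t powr (r - 1) * t powr (1 - r) / 2 powr (1 - r)"
      using t0 by (simp add: powr_divide)
    also have "t powr (r - 1) * t powr (1 - r) = 1"
      using t0 powr_add[of t "r - 1" "1 - r"] by simp
    also have "1 / 2 powr (1 - r) = (2::real) powr (r - 1)"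
      using powr_minus_divide[of 2 "1 - r"] by simp
    finally show ?thesis using powr_add[of 2 1 "r - 1"] by simp
  qed
  finally show ?thesis .
qed

end

section \<open>The boundary measure and the Poisson kernel\<close>

lemma nat_powr_mult_int:
  "0 < q \<Longrightarrow> (of_nat q :: complex) powr (s * of_int k) = (of_nat q powr s) powi k"
  by (simp add: powr_def exp_power_int mult_ac)

locale boundary_measure = rooted_tree adj q orig
  for adj :: "'v \<Rightarrow> 'v \<Rightarrow> bool" and q orig +
  fixes \<nu> :: "(nat \<Rightarrow> 'v) measure"
  assumes \<nu>: "is_boundary_measure adj q orig \<nu>"
begin

sublocale prob_space \<nu>
  using \<nu> by (simp add: is_boundary_measure_def)

lemma space_\<nu>: "space \<nu> = \<Omega>"
  and sets_\<nu>: "sets \<nu> = sigma_sets \<Omega> (range cyl)"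
  using \<nu> by (simp_all add: is_boundary_measure_def)

lemma sets_cyl [measurable]: "cyl x \<in> sets \<nu>"
  unfolding sets_\<nu> by (rule sigma_sets.Basic) (rule rangeI)

lemma q_pos [simp]: "0 < q" "Suc 0 < q" "1 < real q"
  using q_ge_2 by simp_all

lemma measure_cyl:
  assumes "x \<noteq> orig" shows "measure \<nu> (cyl x) = real q / ((real q + 1) * real q ^ lev x)"
proof -
  have "1 \<le> lev x" using assms lev_eq_0_iff[of x] by linarith
  thus ?thesis using \<nu> unfolding is_boundary_measure_def by blast
qed

lemma measure_cyl_orig: "measure \<nu> (cyl orig) = 1"
  using prob_space by (simp add: cyl_orig space_\<nu>)

lemma measure_cyl_le: "measure \<nu> (cyl x) \<le> 1 / real q ^ lev x"
proof (cases "x = orig")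
  case True
  thus ?thesis by (simp add: measure_cyl_orig)
next
  case False
  have "real q / ((real q + 1) * real q ^ lev x) \<le> (real q + 1) / ((real q + 1) * real q ^ lev x)"
    by (intro divide_right_mono) auto
  thus ?thesis by (simp add: measure_cyl[OF False])
qed

lemma measure_cyl_pos: "0 < measure \<nu> (cyl x)"
  by (cases "x = orig") (simp_all add: measure_cyl_orig measure_cyl)

lemma indicator_cyl_children:
  "indicator (cyl x) \<omega> = (\<Sum>y\<in>children x. indicator (cyl y) \<omega> :: 'b :: semiring_1)"
  unfolding cyl_children[of x]
proof (rule indicator_UN_disjoint)
  show "disjoint_family_on cyl (children x)"
    unfolding disjoint_family_on_def
  proof (intro ballI impI)
    fix y z assume "y \<in> children x" "z \<in> children x" "y \<noteq> z"
    thus "cyl y \<inter> cyl z = {}" using children_lev[of y x] children_lev[of z x] by (intro cyl_disjoint) auto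
  qed
qed simp

text \<open>The finitely additive measure with density \<open>F\<close>, evaluated on the cylinder of \<open>x\<close>.\<close>

definition cint :: "((nat \<Rightarrow> 'v) \<Rightarrow> 'b::{banach, second_countable_topology}) \<Rightarrow> 'v \<Rightarrow> 'b" where
  "cint F x = (LINT \<omega>|\<nu>. indicat_real (cyl x) \<omega> *\<^sub>R F \<omega>)"

lemma integrable_cyl: "integrable \<nu> F \<Longrightarrow> integrable \<nu> (\<lambda>\<omega>. indicat_real (cyl x) \<omega> *\<^sub>R F \<omega>)"
  for F :: "_ \<Rightarrow> 'b::{banach, second_countable_topology}"
  by (rule integrable_mult_indicator) auto

lemma cint_children:
  assumes "integrable \<nu> F" shows "cint F x = (\<Sum>y\<in>children x. cint F y)"
  unfolding cint_def indicator_cyl_children[of x] scaleR_sum_left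
  by (rule Bochner_Integration.integral_sum) (rule integrable_cyl[OF assms])

lemma cint_orig: "cint F orig = (LINT \<omega>|\<nu>. F \<omega>)"
  unfolding cint_def by (rule Bochner_Integration.integral_cong) (auto simp: cyl_orig space_\<nu>)

lemma sum_cint_tsphere:
  assumes "integrable \<nu> F" shows "(\<Sum>x\<in>tsphere n. cint F x) = (LINT \<omega>|\<nu>. F \<omega>)"
proof (induction n)
  case 0
  show ?case by (simp add: tsphere_0 cint_orig)
next
  case (Suc n)
  thus ?case by (simp add: sum_tsphere_Suc cint_children[OF assms, symmetric])
qed

abbreviation "kern \<equiv> poisson_kernel_pow adj q orig"
abbreviation "PT s F x \<equiv> (LINT \<omega>|\<nu>. kern s x \<omega> * F \<omega>)"
abbreviation qp :: "complex \<Rightarrow> complex" where "qp s \<equiv> of_nat q powr s"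

lemma qp_nonzero: "qp s \<noteq> 0"
  using q_pos by simp

lemma kern_powi: "kern s x \<omega> = qp s powi hor \<omega> x"
  unfolding poisson_kernel_pow_def by (rule nat_powr_mult_int) simp

lemma kern_orig: "\<omega> \<in> \<Omega> \<Longrightarrow> kern s orig \<omega> = 1"
  by (simp add: kern_powi hor_orig)

text \<open>Off the cylinder of \<open>x\<close>, the index drops by one from the parent to \<open>x\<close>; on it, the index rises by one, which
is what the second summand corrects.\<close>

lemma kern_step:
  assumes x: "x \<noteq> orig" and w: "\<omega> \<in> \<Omega>"
  shows "kern s x \<omega> = qp (-s) * kern s (par x) \<omega> +
    indicat_real (cyl x) \<omega> *\<^sub>R (qp s ^ lev x * (1 - qp (-s) ^ 2))"
proof (cases "\<omega> \<in> cyl x")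
  case True
  have "\<omega> \<in> cyl (par x)" using True cyl_par[OF x] by blast
  hence "kern s (par x) \<omega> = qp s ^ lev (par x)" "kern s x \<omega> = qp s ^ lev x"
    using True by (simp_all add: kern_powi hor_cyl)
  thus ?thesis using True qp_nonzero[of s]
    by (simp add: lev_par[OF x] powr_minus field_simps power2_eq_square)
next
  case False
  thus ?thesis using qp_nonzero[of s]
    by (simp add: kern_powi hor_not_cyl[OF w] powr_minus power_int_diff field_simps)
qed

lemma integrable_kern:
  assumes "integrable \<nu> F" shows "integrable \<nu> (\<lambda>\<omega>. kern s x \<omega> * F \<omega>)"
proof (induction "lev x" arbitrary: x)
  case 0
  hence "x = orig" by simp
  have "integrable \<nu> (\<lambda>\<omega>. kern s x \<omega> * F \<omega>) \<longleftrightarrow> integrable \<nu> F"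
    unfolding \<open>x = orig\<close>
    by (intro Bochner_Integration.integrable_cong) (auto simp: kern_orig space_\<nu>)
  thus ?case using assms by simp
next
  case (Suc n)
  hence x: "x \<noteq> orig" by auto
  have "n = lev (par x)" using Suc.hyps(2) lev_par[OF x] by simp
  note IH = Suc.hyps(1)[OF this]
  let ?G = "\<lambda>\<omega>. qp (-s) * (kern s (par x) \<omega> * F \<omega>) +
    (qp s ^ lev x * (1 - qp (-s) ^ 2)) * (indicat_real (cyl x) \<omega> *\<^sub>R F \<omega>)"
  have "integrable \<nu> (\<lambda>\<omega>. kern s x \<omega> * F \<omega>) \<longleftrightarrow> integrable \<nu> ?G"
    by (intro Bochner_Integration.integrable_cong refl)
      (simp add: kern_step[OF x] space_\<nu> distrib_left distrib_right mult_ac)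
  moreover have "integrable \<nu> ?G"
    by (intro Bochner_Integration.integrable_add integrable_mult_right IH integrable_cyl assms)
  ultimately show ?case by blast
qed

lemma PT_orig: "PT s F orig = cint F orig"
  unfolding cint_orig
  by (intro Bochner_Integration.integral_cong) (auto simp: kern_orig space_\<nu>)

lemma PT_step:
  assumes F: "integrable \<nu> F" and x: "x \<noteq> orig"
  shows "PT s F x = qp (-s) * PT s F (par x) + qp s ^ lev x * (1 - qp (-s) ^ 2) * cint F x"
proof -
  let ?G = "\<lambda>\<omega>. qp (-s) * (kern s (par x) \<omega> * F \<omega>) +
    (qp s ^ lev x * (1 - qp (-s) ^ 2)) * (indicat_real (cyl x) \<omega> *\<^sub>R F \<omega>)"
  have "PT s F x = (LINT \<omega>|\<nu>. ?G \<omega>)"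
    by (intro Bochner_Integration.integral_cong refl)
      (simp add: kern_step[OF x] space_\<nu> distrib_left distrib_right mult_ac)
  also have "\<dots> = qp (-s) * PT s F (par x) + qp s ^ lev x * (1 - qp (-s) ^ 2) * cint F x"
    unfolding cint_def
    by (subst Bochner_Integration.integral_add)
      (intro integrable_mult_right integrable_kern integrable_cyl F | simp only: integral_mult_right_zero)+
  finally show ?thesis .
qed

text \<open>The slope isolates the mass of the cylinder, as the boundary points outside it cancel.\<close>

lemma slope_PT:
  assumes "integrable \<nu> F" "x \<noteq> orig"
  shows "slope s (PT s F) x = qp s ^ lev x * (1 - qp (-s) ^ 2) * cint F x"
  using PT_step[OF assms, of s] assms(2) by (simp add: slope_def)

end

context rooted_tree begin

lemma eq_if_slope_eq:
  assumes "u orig = v orig" "\<And>x. x \<noteq> orig \<Longrightarrow> slope s u x = slope s v x"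
  shows "u = v"
proof
  fix x show "u x = v x"
  proof (induction "lev x" arbitrary: x)
    case 0
    hence "x = orig" by simp
    thus ?case using assms(1) by simp
  next
    case (Suc n)
    hence x: "x \<noteq> orig" by auto
    have "n = lev (par x)" using Suc.hyps(2) lev_par[OF x] by simp
    from Suc.hyps(1)[OF this] show ?case using assms(2)[OF x] x by (simp add: slope_def)
  qed
qed

lemma sum_slope_children:
  "(\<Sum>y\<in>children x. slope s u y)
     = (\<Sum>y\<in>children x. u y) - of_nat (card (children x)) * of_nat q powr (-s) * u x"
proof -
  have "(\<Sum>y\<in>children x. slope s u y) = (\<Sum>y\<in>children x. u y - of_nat q powr (-s) * u x)"
    by (intro sum.cong) (auto simp: slope_def children_def)
  thus ?thesis by (simp add: sum_subtractf)
qed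

lemma gamma_eigenvalue_alt:
  assumes "s = 1/2 + \<i> * z"
  shows "(of_nat q + 1) * gamma_eigenvalue q z = of_nat q powr s + of_nat q * of_nat q powr (-s)"
proof -
  have "(of_nat q :: complex) + 1 \<noteq> 0" by (metis of_nat_Suc of_nat_eq_0_iff add.commute nat.distinct(1))
  moreover have "(of_nat q :: complex) powr (1/2 - \<i> * z) = of_nat q * of_nat q powr (-s)"
  proof -
    have "1/2 - \<i> * z = 1 + (- s)" using assms by simp
    thus ?thesis using q_ge_2 by (simp only: powr_add) simp
  qed
  ultimately show ?thesis unfolding gamma_eigenvalue_def using assms by simp
qed

lemma laplacian_alt: "(of_nat q + 1) * laplacian adj q u x = (\<Sum>y\<in>{y. adj x y}. u y)"
proof -
  have "(of_nat q :: complex) + 1 \<noteq> 0" by (metis of_nat_Suc of_nat_eq_0_iff add.commute nat.distinct(1))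
  thus ?thesis unfolding laplacian_def tdist_eq_1_iff by simp
qed

text \<open>Along a ray, the eigenvalue equation for averages over descendants is the recurrence $q a_{n+1} - (q^s + q^{1-s}) a_n + a_{n-1} = 0$,
whose characteristic roots are $q^{-s}$ and $q^{s-1}$. Taking the slope splits off the first
root; the second one remains, as the factor $q^s$ for a sum over $q$ children.\<close>

lemma eigenfunction_iff_slope:
  assumes s: "s = 1/2 + \<i> * z"
  shows "(\<forall>x. laplacian adj q u x = gamma_eigenvalue q z * u x) \<longleftrightarrow>
    (\<Sum>y\<in>children orig. slope s u y) = (of_nat q powr s - of_nat q powr (-s)) * u orig \<and>
    (\<forall>x. x \<noteq> orig \<longrightarrow> (\<Sum>y\<in>children x. slope s u y) = of_nat q powr s * slope s u x)"
proof -
  have q1: "(of_nat q :: complex) + 1 \<noteq> 0" by (metis of_nat_Suc of_nat_eq_0_iff add.commute nat.distinct(1))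
  have inv: "(of_nat q :: complex) powr s * of_nat q powr (-s) = 1"
    using q_ge_2 by (simp add: powr_minus)
  have *: "laplacian adj q u x = gamma_eigenvalue q z * u x \<longleftrightarrow>
     (\<Sum>y\<in>{y. adj x y}. u y) = (of_nat q powr s + of_nat q * of_nat q powr (-s)) * u x" for x
    unfolding laplacian_alt[symmetric] gamma_eigenvalue_alt[OF s, symmetric]
    using q1 by (simp add: mult.assoc)
  have o: "laplacian adj q u orig = gamma_eigenvalue q z * u orig \<longleftrightarrow>
    (\<Sum>y\<in>children orig. slope s u y) = (of_nat q powr s - of_nat q powr (-s)) * u orig"
    unfolding * neighbours_orig sum_slope_children card_children_orig
    by (auto simp: algebra_simps)
  have x: "laplacian adj q u x = gamma_eigenvalue q z * u x \<longleftrightarrow>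
    (\<Sum>y\<in>children x. slope s u y) = of_nat q powr s * slope s u x" if "x \<noteq> orig" for x
  proof -
    have nb: "(\<Sum>y\<in>{y. adj x y}. u y) = u (par x) + (\<Sum>y\<in>children x. u y)"
      using neighbours[OF that] by simp
    have sl: "of_nat q powr s * slope s u x = of_nat q powr s * u x - u (par x)"
      using inv that by (simp add: slope_def right_diff_distrib mult.assoc[symmetric])
    show ?thesis unfolding * sum_slope_children card_children[OF that] nb sl
      by (auto simp: algebra_simps)
  qed
  have "(\<forall>x. laplacian adj q u x = gamma_eigenvalue q z * u x) \<longleftrightarrow>
      laplacian adj q u orig = gamma_eigenvalue q z * u orig \<and>
      (\<forall>x. x \<noteq> orig \<longrightarrow> laplacian adj q u x = gamma_eigenvalue q z * u x)"
    by metis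
  thus ?thesis unfolding o using x by simp
qed

end

context boundary_measure begin

text \<open>In terms of slopes, the equation is the additivity of \<open>cint\<close>.\<close>

lemma PT_eigenfunction:
  assumes s: "s = 1/2 + \<i> * z" and F: "integrable \<nu> F"
  shows "laplacian adj q (PT s F) x = gamma_eigenvalue q z * PT s F x"
proof -
  have inv: "qp s * qp (-s) = 1" by (simp add: powr_minus qp_nonzero)
  have ch: "(\<Sum>y\<in>children x. slope s (PT s F) y)
      = qp s ^ Suc (lev x) * (1 - qp (-s) ^ 2) * cint F x" for x
  proof -
    have "(\<Sum>y\<in>children x. slope s (PT s F) y)
        = (\<Sum>y\<in>children x. qp s ^ Suc (lev x) * (1 - qp (-s) ^ 2) * cint F y)"
      using slope_PT[OF F children_not_orig] by (intro sum.cong) (simp_all add: children_lev)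
    thus ?thesis by (simp add: sum_distrib_left[symmetric] cint_children[OF F, of x])
  qed
  have "(\<Sum>y\<in>children orig. slope s (PT s F) y) = (qp s - qp (-s)) * PT s F orig"
    unfolding ch using inv by (simp add: PT_orig right_diff_distrib power2_eq_square mult.assoc[symmetric])
  moreover have "(\<Sum>y\<in>children x. slope s (PT s F) y) = qp s * slope s (PT s F) x" if "x \<noteq> orig" for x
    unfolding ch slope_PT[OF F that] by simp
  ultimately show ?thesis using eigenfunction_iff_slope[OF s, of "PT s F"] by blast
qed

end

section \<open>The weak type estimate\<close>

text \<open>Here $a = |q^s|$ and $b = q^{1/r}$, with $ab = q$. The absolute value of the kernel changes by a factor $a$ or
$1/a$ along an edge. The number $\rho = q/a^2$ is the ratio of the geometric series in the
kernel estimates; it is less than $1$ exactly if $\mathrm{Re}\,s > 1/2$, that is $r > 2$.\<close>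

locale poisson_exponent = boundary_measure adj q orig \<nu>
  for adj :: "'v \<Rightarrow> 'v \<Rightarrow> bool" and q orig \<nu> +
  fixes s :: complex and r :: real
  assumes r: "2 < r" and s: "Re s = 1 - 1 / r"
begin

definition a :: real where "a = real q powr Re s"
definition b :: real where "b = real q powr (1 / r)"
definition \<rho> :: real where "\<rho> = real q / a ^ 2"

lemma Re_s_pos: "1 / 2 < Re s" "0 < Re s"
  using r by (simp_all add: s field_simps)

lemma a_gt_1: "1 < a" and a_pos: "0 < a"
proof -
  have "real q powr 0 < real q powr Re s" using Re_s_pos by (intro powr_less_mono) auto
  thus "1 < a" using q_ge_2 by (simp add: a_def split: if_splits)
  thus "0 < a" by simp
qed

lemma b_gt_1: "1 < b"
proof -
  have "real q powr 0 < real q powr (1 / r)" using r by (intro powr_less_mono) auto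
  thus ?thesis using q_ge_2 by (simp add: b_def split: if_splits)
qed

lemma a_times_b: "a * b = real q"
  unfolding a_def b_def by (simp add: powr_add[symmetric] s)

lemma a_eq_b_powr: "a = b powr (r - 1)"
  using r by (simp add: a_def b_def powr_powr s field_simps)

lemma \<rho>: "0 < \<rho>" "\<rho> < 1"
proof -
  show "0 < \<rho>" using a_pos by (simp add: \<rho>_def)
  have "real q powr 1 < real q powr (Re s * 2)" using Re_s_pos by (intro powr_less_mono) auto
  also have "real q powr (Re s * 2) = a ^ 2"
    using a_pos by (simp add: a_def powr_powr[symmetric])
  finally show "\<rho> < 1" using a_pos by (simp add: \<rho>_def)
qed

lemma norm_qp: "norm (qp s) = a" "norm (qp (-s)) = 1 / a"
  by (simp_all add: norm_nat_powr a_def powr_minus_divide norm_divide)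

text \<open>The same recursion as for the kernel, as an inequality without cancellation.\<close>

lemma norm_kern_step:
  assumes x: "x \<noteq> orig" and w: "\<omega> \<in> \<Omega>"
  shows "norm (kern s x \<omega>) \<le> norm (kern s (par x) \<omega>) / a + indicat_real (cyl x) \<omega> * a ^ lev x"
proof (cases "\<omega> \<in> cyl x")
  case True
  hence "norm (kern s x \<omega>) = a ^ lev x"
    by (simp add: kern_powi hor_cyl norm_power norm_qp)
  thus ?thesis using True a_pos by simp
next
  case False
  hence "kern s x \<omega> = qp (-s) * kern s (par x) \<omega>" using kern_step[OF x w] by simp
  thus ?thesis using False by (simp add: norm_mult norm_qp)
qed

abbreviation "NT G x \<equiv> (LINT \<omega>|\<nu>. norm (kern s x \<omega>) * (G \<omega> :: real))"

lemma integrable_norm_kern: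
  assumes "integrable \<nu> G" "\<And>\<omega>. 0 \<le> G \<omega>"
  shows "integrable \<nu> (\<lambda>\<omega>. norm (kern s x \<omega>) * G \<omega>)"
proof -
  have "integrable \<nu> (\<lambda>\<omega>. complex_of_real (G \<omega>))" using assms(1) by (rule integrable_of_real)
  from integrable_norm[OF integrable_kern[OF this, of s x]] show ?thesis
    using assms(2) by (simp add: norm_mult)
qed

lemma NT_nonneg: "(\<And>\<omega>. 0 \<le> G \<omega>) \<Longrightarrow> 0 \<le> NT G x"
  by (intro integral_nonneg_AE AE_I2) simp

lemma NT_orig: "NT G orig = (LINT \<omega>|\<nu>. G \<omega>)"
  by (rule Bochner_Integration.integral_cong) (simp_all add: kern_orig space_\<nu>)

lemma NT_step:
  assumes G: "integrable \<nu> G" "\<And>\<omega>. 0 \<le> G \<omega>" and x: "x \<noteq> orig"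
  shows "NT G x \<le> NT G (par x) / a + a ^ lev x * cint G x"
proof -
  have "NT G x \<le> (LINT \<omega>|\<nu>. 1 / a * (norm (kern s (par x) \<omega>) * G \<omega>)
      + a ^ lev x * (indicat_real (cyl x) \<omega> *\<^sub>R G \<omega>))"
  proof (intro integral_mono integrable_norm_kern G Bochner_Integration.integrable_add
      integrable_mult_right integrable_cyl)
    fix \<omega> assume "\<omega> \<in> space \<nu>"
    hence "norm (kern s x \<omega>) * G \<omega> \<le>
        (norm (kern s (par x) \<omega>) / a + indicat_real (cyl x) \<omega> * a ^ lev x) * G \<omega>"
      using norm_kern_step[OF x] G(2) by (intro mult_right_mono) (auto simp: space_\<nu>)
    thus "norm (kern s x \<omega>) * G \<omega> \<le> 1 / a * (norm (kern s (par x) \<omega>) * G \<omega>)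
      + a ^ lev x * (indicat_real (cyl x) \<omega> *\<^sub>R G \<omega>)"
      by (simp add: distrib_left distrib_right mult_ac)
  qed
  also have "\<dots> = 1 / a * NT G (par x) + a ^ lev x * cint G x"
    unfolding cint_def
    by (subst Bochner_Integration.integral_add)
      (intro integrable_mult_right integrable_norm_kern integrable_cyl G | simp only: integral_mult_right_zero)+
  finally show ?thesis by simp
qed

text \<open>The $L^\infty$ endpoint: $\int |p^s(x,\cdot)| \, d\nu$ is of order $(a/q)^{|x|} = b^{-|x|}$, by
induction along the path to the root. The constant is the fixed point of $K \mapsto \rho K + 1$.\<close>

lemma NT_le_of_bounded:
  assumes G: "integrable \<nu> G" "\<And>\<omega>. 0 \<le> G \<omega>" and le: "\<And>\<omega>. \<omega> \<in> \<Omega> \<Longrightarrow> G \<omega> \<le> \<Lambda>" and L: "0 \<le> \<Lambda>"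
  shows "NT G x \<le> \<Lambda> / (1 - \<rho>) / b ^ lev x"
proof (induction "lev x" arbitrary: x)
  case 0
  hence x: "x = orig" by simp
  have "NT G x \<le> (LINT \<omega>|\<nu>. \<Lambda>)"
    unfolding x NT_orig using G le by (intro integral_mono) (auto simp: space_\<nu>)
  also have "\<dots> = \<Lambda>" using prob_space by simp
  also have "\<dots> \<le> \<Lambda> / (1 - \<rho>)" using L \<rho> by (simp add: field_simps)
  finally show ?case by (simp add: x)
next
  case (Suc n)
  hence x: "x \<noteq> orig" by auto
  have n: "n = lev (par x)" using Suc.hyps(2) lev_par[OF x] by simp
  have "cint G x \<le> (LINT \<omega>|\<nu>. indicat_real (cyl x) \<omega> *\<^sub>R \<Lambda>)"
    unfolding cint_def using le
    by (intro integral_mono integrable_cyl G) (auto simp: indicator_def space_\<nu>)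
  also have "\<dots> = measure \<nu> (cyl x) * \<Lambda>"
    using cyl_subset[of x] by (simp add: space_\<nu> Int_absorb2)
  also have "\<dots> \<le> 1 / real q ^ lev x * \<Lambda>" by (intro mult_right_mono measure_cyl_le L)
  finally have c: "cint G x \<le> \<Lambda> / real q ^ lev x" by simp
  have "NT G x \<le> NT G (par x) / a + a ^ lev x * cint G x" by (rule NT_step[OF G x])
  also have "\<dots> \<le> (\<Lambda> / (1 - \<rho>) / b ^ n) / a + a ^ lev x * (\<Lambda> / real q ^ lev x)"
    using Suc.hyps(1)[OF n] c a_pos n by (intro add_mono divide_right_mono mult_left_mono) auto
  also have "real q ^ lev x = a ^ lev x * b ^ lev x"
    by (simp add: a_times_b[symmetric] power_mult_distrib)
  also have "a ^ lev x * (\<Lambda> / (a ^ lev x * b ^ lev x)) = \<Lambda> / b ^ lev x"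
    using a_pos by simp
  also have "(\<Lambda> / (1 - \<rho>) / b ^ n) / a = \<rho> * (\<Lambda> / (1 - \<rho>)) / b ^ lev x"
  proof -
    have "b / a = \<rho>" using a_pos by (simp add: \<rho>_def a_times_b[symmetric] power2_eq_square)
    moreover have "X / b ^ n / a = b / a * X / b ^ Suc n" for X using a_pos b_gt_1 by simp
    ultimately show ?thesis unfolding Suc.hyps(2)[symmetric] by (simp only:)
  qed
  also have "\<rho> * (\<Lambda> / (1 - \<rho>)) / b ^ lev x + \<Lambda> / b ^ lev x = \<Lambda> / (1 - \<rho>) / b ^ lev x"
  proof -
    have "\<rho> * (\<Lambda> / (1 - \<rho>)) + \<Lambda> = \<Lambda> / (1 - \<rho>)" using \<rho> by (simp add: field_simps)
    thus ?thesis by (simp only: add_divide_distrib[symmetric])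
  qed
  finally show ?case .
qed

text \<open>The $L^1$ endpoint, again with ratio $\rho$, since a vertex has $q$ children and each step
divides the kernel by $a$. The root has one more child, so the first step is
estimated separately.\<close>

lemma sum_NT_tsphere:
  assumes G: "integrable \<nu> G" "\<And>\<omega>. 0 \<le> G \<omega>"
  shows "(\<Sum>x\<in>tsphere n. NT G x) \<le> (real q + 2) / (1 - \<rho>) * a ^ n * (LINT \<omega>|\<nu>. G \<omega>)"
proof -
  define I where "I = (LINT \<omega>|\<nu>. G \<omega>)"
  have I: "0 \<le> I" unfolding I_def using G(2) by (intro integral_nonneg_AE AE_I2)
  define K where "K = (real q + 2) / (1 - \<rho>)"
  have K: "real q + 2 + \<rho> * K = K" using \<rho> by (simp add: K_def field_simps)
  have K0: "real q + 2 \<le> K" using \<rho> by (simp add: K_def field_simps)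
  have step: "(\<Sum>x\<in>tsphere (Suc n). NT G x)
      \<le> (\<Sum>w\<in>tsphere n. real (card (children w)) * (NT G w / a)) + a ^ Suc n * I" for n
  proof -
    have "(\<Sum>x\<in>tsphere (Suc n). NT G x)
        \<le> (\<Sum>x\<in>tsphere (Suc n). NT G (par x) / a + a ^ Suc n * cint G x)"
    proof (intro sum_mono)
      fix x assume "x \<in> tsphere (Suc n)"
      hence "lev x = Suc n" by (simp add: tsphere_def)
      moreover from this have "x \<noteq> orig" by auto
      ultimately show "NT G x \<le> NT G (par x) / a + a ^ Suc n * cint G x"
        using NT_step[OF G, of x] by simp
    qed
    also have "\<dots> = (\<Sum>x\<in>tsphere (Suc n). NT G (par x) / a) + a ^ Suc n * I"
      using sum_cint_tsphere[OF G(1), of "Suc n"]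
      by (simp only: sum.distrib sum_distrib_left[symmetric] I_def)
    also have "(\<Sum>x\<in>tsphere (Suc n). NT G (par x) / a)
        = (\<Sum>w\<in>tsphere n. real (card (children w)) * (NT G w / a))"
      unfolding sum_tsphere_Suc by (intro sum.cong refl) (simp add: children_par)
    finally show ?thesis .
  qed
  have "(\<Sum>x\<in>tsphere n. NT G x) \<le> K * (a ^ n * I)"
  proof (induction n)
    case 0
    have "1 * I \<le> K * I" using K0 I by (intro mult_right_mono) auto
    thus ?case by (simp add: tsphere_0 NT_orig I_def)
  next
    case (Suc n)
    show ?case
    proof (cases "n = 0")
      case True
      have "(\<Sum>x\<in>tsphere (Suc n). NT G x) \<le> (real q + 1) * (I / a) + a * I"
        using step[of n] by (simp add: True tsphere_0 NT_orig card_children_orig I_def add.commute)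
      also have "\<dots> \<le> (real q + 1) * (a * I) + a * I"
      proof -
        have "1 \<le> a * a" using mult_mono[of 1 a 1 a] a_gt_1 by simp
        hence "1 * I \<le> (a * a) * I" using I by (intro mult_right_mono)
        hence "I / a \<le> a * I" using a_pos by (simp add: field_simps)
        thus ?thesis using a_pos by (intro add_mono mult_left_mono) auto
      qed
      also have "\<dots> = (real q + 2) * (a * I)" by (simp add: algebra_simps)
      also have "\<dots> \<le> K * (a * I)" using K0 a_pos I by (intro mult_right_mono) auto
      finally show ?thesis by (simp add: True)
    next
      case False
      have "(\<Sum>w\<in>tsphere n. real (card (children w)) * (NT G w / a))
          = (\<Sum>w\<in>tsphere n. real q / a * NT G w)"
      proof (intro sum.cong refl)
        fix w assume "w \<in> tsphere n"
        hence "w \<noteq> orig" using False by (auto simp: tsphere_def)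
        thus "real (card (children w)) * (NT G w / a) = real q / a * NT G w"
          by (simp add: card_children)
      qed
      also have "\<dots> = real q / a * (\<Sum>w\<in>tsphere n. NT G w)" by (simp add: sum_distrib_left)
      also have "\<dots> \<le> real q / a * (K * (a ^ n * I))"
        using Suc a_pos by (intro mult_left_mono) auto
      also have "\<dots> = \<rho> * K * (a ^ Suc n * I)"
        using a_pos by (simp add: \<rho>_def field_simps power2_eq_square)
      finally have "(\<Sum>x\<in>tsphere (Suc n). NT G x) \<le> \<rho> * K * (a ^ Suc n * I) + 1 * (a ^ Suc n * I)"
        using step[of n] by simp
      also have "\<dots> = (\<rho> * K + 1) * (a ^ Suc n * I)" by (simp only: distrib_right)
      also have "\<dots> \<le> K * (a ^ Suc n * I)" using K I a_pos by (intro mult_right_mono) auto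
      finally show ?thesis .
    qed
  qed
  thus ?thesis by (simp add: K_def I_def)
qed

lemma integrable_Lp:
  assumes "F \<in> Lp_space \<nu> r"
  shows "integrable \<nu> F" "integrable \<nu> (\<lambda>\<omega>. norm (F \<omega>) powr r)" "F \<in> borel_measurable \<nu>"
proof -
  show m: "F \<in> borel_measurable \<nu>" and i: "integrable \<nu> (\<lambda>\<omega>. norm (F \<omega>) powr r)"
    using assms by (auto simp: Lp_space_def)
  have "norm (F \<omega>) \<le> norm (1 + norm (F \<omega>) powr r)" for \<omega>
  proof (cases "norm (F \<omega>) \<le> 1")
    case False
    hence "norm (F \<omega>) powr 1 \<le> norm (F \<omega>) powr r" using r by (intro powr_mono) auto
    thus ?thesis using False by simp
  qed (simp add: add_increasing2)
  thus "integrable \<nu> F"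
    using m i by (intro Bochner_Integration.integrable_bound[of \<nu> "\<lambda>\<omega>. 1 + norm (F \<omega>) powr r" F]) auto
qed

text \<open>The factors come from the half of \<open>t\<close> left to the large part of \<open>F\<close>, from \<open>sum_NT_tsphere\<close>,
from \<open>sum_powers_below\<close>, and from the truncation height.\<close>

definition C_up :: real where
  "C_up = 2 * ((real q + 2) / (1 - \<rho>)) * (a / (a - 1)) * ((1 - \<rho>) / 2) powr (1 - r)"

lemma C_up_pos: "0 < C_up"
  using \<rho> a_gt_1 unfolding C_up_def by (intro mult_pos_pos divide_pos_pos) auto

text \<open>Real interpolation between the two endpoints, with a truncation height that grows with the level.\<close>

lemma weak_bound_PT:
  assumes F: "F \<in> Lp_space \<nu> r"
  shows "weak_bound r (C_up * (LINT \<omega>|\<nu>. norm (F \<omega>) powr r)) (PT s F)"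
  unfolding weak_bound_def
proof (intro allI impI)
  fix t :: real assume t: "0 < t"
  note [measurable] = integrable_Lp(3)[OF F]
  define f where "f = (\<lambda>\<omega>. norm (F \<omega>))"
  have f: "integrable \<nu> f" "\<And>\<omega>. 0 \<le> f \<omega>" and fr: "integrable \<nu> (\<lambda>\<omega>. f \<omega> powr r)"
    unfolding f_def using integrable_Lp[OF F] by auto
  note [measurable] = borel_measurable_integrable[OF f(1)]
  \<comment> \<open>With the height \<open>c * t * b ^ n\<close>, \<open>NT_le_of_bounded\<close> gives exactly \<open>t / 2\<close> on the sphere of radius \<open>n\<close>.\<close>
  define c where "c = (1 - \<rho>) / 2"
  have c: "0 < c" using \<rho> by (simp add: c_def)
  define K where "K = (real q + 2) / (1 - \<rho>)"
  have K: "0 < K" using \<rho> by (simp add: K_def)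
  define Y where "Y = (\<lambda>\<omega>. f \<omega> / (c * t))"
  have Y: "0 \<le> Y \<omega>" for \<omega> using f(2) c t by (simp add: Y_def)
  define V where "V = (\<lambda>n \<omega>. if b ^ n < Y \<omega> then f \<omega> else 0)"
  define W where "W = (\<lambda>n \<omega>. if b ^ n < Y \<omega> then 0 else f \<omega>)"
  have [measurable]: "Y \<in> borel_measurable \<nu>" unfolding Y_def by measurable
  have V: "integrable \<nu> (V n)" "0 \<le> V n \<omega>" and W: "integrable \<nu> (W n)" "0 \<le> W n \<omega>" for n \<omega>
  proof -
    show "integrable \<nu> (V n)" "integrable \<nu> (W n)" unfolding V_def W_def
      by (rule Bochner_Integration.integrable_bound[OF f(1)]; simp add: f(2))+
  qed (simp_all add: V_def W_def f(2))
  let ?S = "\<lambda>n. {x \<in> tsphere n. t < norm (PT s F x)}"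
  have level: "real (card (?S n)) * (t / 2) \<le> K * a ^ n * (LINT \<omega>|\<nu>. V n \<omega>)" for n
  proof -
    have "t / 2 \<le> NT (V n) x" if x: "x \<in> ?S n" for x
    proof -
      have "t < norm (PT s F x)" using x by simp
      also have "\<dots> \<le> (LINT \<omega>|\<nu>. norm (kern s x \<omega> * F \<omega>))" by (rule integral_norm_bound)
      also have "\<dots> = (LINT \<omega>|\<nu>. norm (kern s x \<omega>) * V n \<omega> + norm (kern s x \<omega>) * W n \<omega>)"
        by (intro Bochner_Integration.integral_cong refl) (simp add: V_def W_def f_def norm_mult)
      also have "\<dots> = NT (V n) x + NT (W n) x"
        by (intro Bochner_Integration.integral_add integrable_norm_kern V W)
      also have "NT (W n) x \<le> (c * t * b ^ n) / (1 - \<rho>) / b ^ lev x"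
      proof (rule NT_le_of_bounded[OF W])
        fix \<omega> show "W n \<omega> \<le> c * t * b ^ n"
          using c t b_gt_1 by (auto simp: W_def Y_def not_less field_simps)
      qed (use c t b_gt_1 in simp)
      also have "\<dots> = t / 2"
        using x \<rho> b_gt_1 by (simp add: tsphere_def c_def field_simps)
      finally show ?thesis by simp
    qed
    hence "(\<Sum>x\<in>?S n. t / 2) \<le> (\<Sum>x\<in>?S n. NT (V n) x)" by (intro sum_mono) auto
    also have "\<dots> \<le> (\<Sum>x\<in>tsphere n. NT (V n) x)"
      using NT_nonneg[OF V(2)] by (intro sum_mono2) auto
    also have "\<dots> \<le> K * a ^ n * (LINT \<omega>|\<nu>. V n \<omega>)"
      unfolding K_def by (rule sum_NT_tsphere[OF V])
    finally show ?thesis by simp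
  qed
  have card_le: "real (card G) \<le> C_up * (LINT \<omega>|\<nu>. f \<omega> powr r) * t powr (-r)"
    if G: "G \<subseteq> {x. t < norm (PT s F x)}" "finite G" for G
  proof -
    obtain N where N: "\<forall>n\<in>lev ` G. n < N" using G(2) finite_nat_set_iff_bounded[of "lev ` G"] by auto
    have "G \<subseteq> (\<Union>n<N. ?S n)" using G(1) N by (auto simp: tsphere_def)
    hence "card G \<le> card (\<Union>n<N. ?S n)" by (intro card_mono) auto
    also have "\<dots> \<le> (\<Sum>n<N. card (?S n))" by (rule card_UN_le) simp
    finally have "real (card G) * (t / 2) \<le> (\<Sum>n<N. real (card (?S n))) * (t / 2)"
      using t by (intro mult_right_mono) (auto simp flip: of_nat_sum)
    also have "\<dots> \<le> (\<Sum>n<N. K * (LINT \<omega>|\<nu>. a ^ n * V n \<omega>))"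
      unfolding sum_distrib_right using level by (intro sum_mono) (simp add: mult.assoc)
    also have "\<dots> = K * (LINT \<omega>|\<nu>. (\<Sum>n<N. a ^ n * V n \<omega>))"
      by (subst Bochner_Integration.integral_sum)
        (auto simp: sum_distrib_left intro!: V)
    also have "(LINT \<omega>|\<nu>. (\<Sum>n<N. a ^ n * V n \<omega>))
        \<le> (LINT \<omega>|\<nu>. a / (a - 1) * (c * t) powr (1 - r) * f \<omega> powr r)"
    proof (intro integral_mono Bochner_Integration.integrable_sum integrable_mult_right V fr)
      fix \<omega>
      \<comment> \<open>As \<open>a\<close> is \<open>b powr (r - 1)\<close>, the levels that see \<open>\<omega>\<close> in the large part are cut off by powers of \<open>a\<close>.\<close>
      have iff: "b ^ n < Y \<omega> \<longleftrightarrow> a ^ n < Y \<omega> powr (r - 1)" for n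
      proof -
        have "a ^ n = (b ^ n) powr (r - 1)" using b_gt_1 by (simp add: a_eq_b_powr power_powr)
        thus ?thesis
          using powr_less_mono2[of "r - 1" "b ^ n" "Y \<omega>"] powr_mono2[of "r - 1" "Y \<omega>" "b ^ n"]
            r b_gt_1 Y[of \<omega>] by (auto simp: not_le[symmetric])
      qed
      have "(\<Sum>n<N. a ^ n * V n \<omega>) = f \<omega> * (\<Sum>n<N. if a ^ n < Y \<omega> powr (r - 1) then a ^ n else 0)"
        by (auto simp: sum_distrib_left V_def iff intro!: sum.cong)
      also have "\<dots> \<le> f \<omega> * (a / (a - 1) * Y \<omega> powr (r - 1))"
        by (intro mult_left_mono sum_powers_below a_gt_1 f) simp
      also have "\<dots> = a / (a - 1) * (f \<omega> * Y \<omega> powr (r - 1))" by simp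
      also have "f \<omega> * Y \<omega> powr (r - 1) = (c * t) powr (1 - r) * f \<omega> powr r"
      proof -
        have "f \<omega> powr 1 * f \<omega> powr (r - 1) = f \<omega> powr r" by (simp only: powr_add[symmetric]) simp
        moreover have "1 / (c * t) powr (r - 1) = (c * t) powr (1 - r)"
          using powr_minus_divide[of "c * t" "r - 1"] by simp
        ultimately show ?thesis
          using f(2)[of \<omega>] c t by (simp add: Y_def powr_divide field_simps)
      qed
      finally show "(\<Sum>n<N. a ^ n * V n \<omega>) \<le> a / (a - 1) * (c * t) powr (1 - r) * f \<omega> powr r"
        by (simp add: mult_ac)
    qed
    also have "\<dots> = a / (a - 1) * (c * t) powr (1 - r) * (LINT \<omega>|\<nu>. f \<omega> powr r)" by simp
    finally have "real (card G) * (t / 2)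
        \<le> K * (a / (a - 1) * (c * t) powr (1 - r) * (LINT \<omega>|\<nu>. f \<omega> powr r))"
      using K by simp
    hence le: "real (card G) * (t / 2) * (2 / t)
        \<le> K * (a / (a - 1) * (c * t) powr (1 - r) * (LINT \<omega>|\<nu>. f \<omega> powr r)) * (2 / t)"
      using t by (intro mult_right_mono) auto
    have "real (card G) = real (card G) * (t / 2) * (2 / t)" using t by simp
    also have "\<dots> \<le> K * (a / (a - 1) * (c * t) powr (1 - r) * (LINT \<omega>|\<nu>. f \<omega> powr r)) * (2 / t)"
      by (rule le)
    also have "\<dots> = 2 * K * (a / (a - 1)) * c powr (1 - r) * (LINT \<omega>|\<nu>. f \<omega> powr r) * (t powr (1 - r) / t)"
      using c t by (simp add: powr_mult)
    also have "t powr (1 - r) / t = t powr (-r)" using t powr_diff[of t "1 - r" 1] by simp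
    finally show ?thesis by (simp add: C_up_def K_def c_def)
  qed
  define B where "B = C_up * (LINT \<omega>|\<nu>. f \<omega> powr r) * t powr (-r)"
  have B: "card G \<le> nat \<lfloor>B\<rfloor>" if "G \<subseteq> {x. t < norm (PT s F x)}" "finite G" for G
    using card_le[OF that] by (simp add: B_def le_nat_floor)
  have "finite {x. t < norm (PT s F x)}"
    using finite_if_finite_subsets_card_bdd[OF B] by blast
  thus "finite {x. t < norm (PT s F x)} \<and>
      real (card {x. t < norm (PT s F x)}) \<le> C_up * (LINT \<omega>|\<nu>. norm (F \<omega>) powr r) * t powr (-r)"
    using card_le[OF subset_refl] by (simp add: f_def)
qed

end

section \<open>Martingales on the boundary\<close>

context boundary_measure begin

lemma cyl_antimono: "\<omega> \<in> \<Omega> \<Longrightarrow> m \<le> n \<Longrightarrow> cyl (\<omega> n) \<subseteq> cyl (\<omega> m)"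
proof (rule lift_Suc_antimono_le[of "\<lambda>n. cyl (\<omega> n)"])
  fix n assume w: "\<omega> \<in> \<Omega>"
  have "\<omega> (Suc n) \<noteq> orig" using boundary_lev[OF w, of "Suc n"] lev_orig by (metis nat.distinct(1))
  thus "cyl (\<omega> (Suc n)) \<subseteq> cyl (\<omega> n)" using cyl_par boundary_par[OF w, of n] by metis
qed

lemma cyl_nested: "lev x \<le> lev y \<Longrightarrow> cyl x \<inter> cyl y = {} \<or> cyl x \<inter> cyl y = cyl y"
proof -
  assume le: "lev x \<le> lev y"
  have "cyl y \<subseteq> cyl x" if "\<omega> \<in> cyl x" "\<omega> \<in> cyl y" for \<omega>
    using cyl_antimono[OF _ le, of \<omega>] that unfolding cyl_iff by metis
  thus ?thesis by blast
qed

lemma Int_stable_cyl: "Int_stable (insert {} (range cyl))"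
proof (rule Int_stableI)
  fix A B assume "A \<in> insert {} (range cyl)" "B \<in> insert {} (range cyl)"
  moreover have "cyl x \<inter> cyl y \<in> insert {} (range cyl)" for x y
  proof (cases "lev x \<le> lev y")
    case True
    thus ?thesis using cyl_nested[of x y] by auto
  next
    case False
    thus ?thesis using cyl_nested[of y x] by (auto simp: Int_commute)
  qed
  ultimately show "A \<inter> B \<in> insert {} (range cyl)" by auto
qed

lemma sets_\<nu>_insert: "sets \<nu> = sigma_sets \<Omega> (insert {} (range cyl))"
  unfolding sets_\<nu>
  by (rule sigma_sets_eqI) (auto intro: sigma_sets.Basic sigma_sets.Empty)

text \<open>The cylinders, with the empty set, form a generator that is stable under intersections.\<close>

lemma AE_eq_if_cint_eq:
  fixes F G :: "(nat \<Rightarrow> 'v) \<Rightarrow> complex"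
  assumes F: "integrable \<nu> F" and G: "integrable \<nu> G" and eq: "\<And>x. cint F x = cint G x"
  shows "AE \<omega> in \<nu>. F \<omega> = G \<omega>"
proof (rule density_unique_banach[OF F G])
  have si: "set_integrable \<nu> A H" if "A \<in> sets \<nu>" "integrable \<nu> H" for A and H :: "_ \<Rightarrow> complex"
    unfolding set_integrable_def by (rule integrable_mult_indicator[OF that])
  have total: "(LINT \<omega>|\<nu>. F \<omega>) = (LINT \<omega>|\<nu>. G \<omega>)" using eq[of orig] by (simp add: cint_orig)
  have cyls: "insert {} (range cyl) \<subseteq> Pow \<Omega>" using cyl_subset by auto
  fix A assume "A \<in> sets \<nu>"
  hence "A \<in> sigma_sets \<Omega> (insert {} (range cyl))" by (simp add: sets_\<nu>_insert)
  with Int_stable_cyl cyls show "(LINT \<omega>:A|\<nu>. F \<omega>) = (LINT \<omega>:A|\<nu>. G \<omega>)"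
  proof (induction rule: sigma_sets_induct_disjoint)
    case (basic A)
    thus ?case using eq by (auto simp: set_lebesgue_integral_def cint_def)
  next
    case empty
    show ?case by (simp add: set_lebesgue_integral_def)
  next
    case (compl A)
    hence A: "A \<in> sets \<nu>" by (simp add: sets_\<nu>_insert)
    have "(LINT \<omega>:(\<Omega> - A)|\<nu>. H \<omega>) = (LINT \<omega>|\<nu>. H \<omega>) - (LINT \<omega>:A|\<nu>. H \<omega>)"
      if H: "integrable \<nu> H" for H :: "_ \<Rightarrow> complex"
    proof -
      have "(LINT \<omega>:(\<Omega> - A)|\<nu>. H \<omega>) = (LINT \<omega>|\<nu>. H \<omega> - indicat_real A \<omega> *\<^sub>R H \<omega>)"
        unfolding set_lebesgue_integral_def
        by (intro Bochner_Integration.integral_cong) (auto simp: space_\<nu> indicator_def)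
      also have "\<dots> = (LINT \<omega>|\<nu>. H \<omega>) - (LINT \<omega>:A|\<nu>. H \<omega>)"
        unfolding set_lebesgue_integral_def
        by (intro Bochner_Integration.integral_diff H integrable_mult_indicator A)
      finally show ?thesis .
    qed
    thus ?case using F G compl total by simp
  next
    case (union A)
    hence A: "A i \<in> sets \<nu>" for i by (auto simp: sets_\<nu>_insert)
    have "(LINT \<omega>:(\<Union>i. A i)|\<nu>. H \<omega>) = (\<Sum>i. (LINT \<omega>:A i|\<nu>. H \<omega>))"
      if H: "integrable \<nu> H" for H :: "_ \<Rightarrow> complex"
      using A union(1) by (intro lebesgue_integral_countable_add si H)
        (auto simp: disjoint_family_on_def)
    thus ?case using F G union by simp
  qed
qed

lemma level_sum:
  fixes c :: "'v \<Rightarrow> 'b::{banach, second_countable_topology}"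
  assumes w: "\<omega> \<in> \<Omega>" shows "(\<Sum>x\<in>tsphere n. indicat_real (cyl x) \<omega> *\<^sub>R c x) = c (\<omega> n)"
proof -
  have "(\<Sum>x\<in>tsphere n. indicat_real (cyl x) \<omega> *\<^sub>R c x)
      = (\<Sum>x\<in>tsphere n. if x = \<omega> n then c x else 0)"
    using w by (intro sum.cong) (auto simp: tsphere_def cyl_iff indicator_def)
  also have "\<dots> = c (\<omega> n)"
  proof -
    have "\<omega> n \<in> tsphere n" using boundary_lev[OF w] by (simp add: tsphere_def)
    thus ?thesis by simp
  qed
  finally show ?thesis .
qed

lemma
  fixes c :: "'v \<Rightarrow> 'b::{banach, second_countable_topology}"
  shows integrable_level: "integrable \<nu> (\<lambda>\<omega>. c (\<omega> n))"
    and integral_level: "(LINT \<omega>|\<nu>. c (\<omega> n)) = (\<Sum>x\<in>tsphere n. measure \<nu> (cyl x) *\<^sub>R c x)"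
proof -
  have i: "integrable \<nu> (\<lambda>\<omega>. indicat_real (cyl x) \<omega> *\<^sub>R c x)" for x
    by (intro integrable_mult_indicator) auto
  hence "integrable \<nu> (\<lambda>\<omega>. \<Sum>x\<in>tsphere n. indicat_real (cyl x) \<omega> *\<^sub>R c x)"
    by (rule Bochner_Integration.integrable_sum)
  moreover have "integrable \<nu> (\<lambda>\<omega>. \<Sum>x\<in>tsphere n. indicat_real (cyl x) \<omega> *\<^sub>R c x)
      \<longleftrightarrow> integrable \<nu> (\<lambda>\<omega>. c (\<omega> n))"
    by (intro Bochner_Integration.integrable_cong refl level_sum) (simp add: space_\<nu>)
  ultimately show "integrable \<nu> (\<lambda>\<omega>. c (\<omega> n))" by blast
  have "(LINT \<omega>|\<nu>. c (\<omega> n)) = (LINT \<omega>|\<nu>. (\<Sum>x\<in>tsphere n. indicat_real (cyl x) \<omega> *\<^sub>R c x))"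
    by (intro Bochner_Integration.integral_cong refl level_sum[symmetric]) (simp add: space_\<nu>)
  also have "\<dots> = (\<Sum>x\<in>tsphere n. (LINT \<omega>|\<nu>. indicat_real (cyl x) \<omega> *\<^sub>R c x))"
    by (rule Bochner_Integration.integral_sum) (rule i)
  also have "\<dots> = (\<Sum>x\<in>tsphere n. measure \<nu> (cyl x) *\<^sub>R c x)"
  proof (intro sum.cong refl)
    fix x
    have "(LINT \<omega>|\<nu>. indicat_real (cyl x) \<omega> *\<^sub>R c x) = (LINT \<omega>|\<nu>. indicat_real (cyl x) \<omega>) *\<^sub>R c x"
      by (intro integral_scaleR_left integrable_real_indicator sets_cyl)
        (simp add: emeasure_eq_measure)
    thus "(LINT \<omega>|\<nu>. indicat_real (cyl x) \<omega> *\<^sub>R c x) = measure \<nu> (cyl x) *\<^sub>R c x"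
      by (simp add: space_\<nu> Int_absorb2[OF cyl_subset])
  qed
  finally show "(LINT \<omega>|\<nu>. c (\<omega> n)) = (\<Sum>x\<in>tsphere n. measure \<nu> (cyl x) *\<^sub>R c x)" .
qed

text \<open>The average density on the cylinder of \<open>x\<close>. Along a ray \<open>\<omega>\<close>, the values \<open>cavg m (\<omega> n)\<close>
form a martingale if \<open>m\<close> is additive.\<close>

definition cavg :: "('v \<Rightarrow> complex) \<Rightarrow> 'v \<Rightarrow> complex" where
  "cavg m x = m x / measure \<nu> (cyl x)"

lemma cint_level_martingale:
  assumes m: "\<And>x. m x = (\<Sum>y\<in>children x. m y)" and "lev x \<le> n"
  shows "cint (\<lambda>\<omega>. cavg m (\<omega> n)) x = m x"
  using assms(2)
proof (induction "n - lev x" arbitrary: x)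
  case 0
  hence n: "n = lev x" by simp
  define c where "c y = (if y = x then cavg m y else 0)" for y
  have "cint (\<lambda>\<omega>. cavg m (\<omega> n)) x = (LINT \<omega>|\<nu>. c (\<omega> n))"
    unfolding cint_def c_def
    by (intro Bochner_Integration.integral_cong) (auto simp: n cyl_iff space_\<nu> indicator_def)
  also have "\<dots> = (\<Sum>y\<in>tsphere n. if y = x then measure \<nu> (cyl y) *\<^sub>R cavg m y else 0)"
    unfolding integral_level by (intro sum.cong) (auto simp: c_def)
  also have "\<dots> = measure \<nu> (cyl x) *\<^sub>R cavg m x"
  proof -
    have "x \<in> tsphere n" by (simp add: tsphere_def n)
    thus ?thesis by simp
  qed
  also have "\<dots> = m x" using measure_cyl_pos[of x] by (simp add: cavg_def scaleR_conv_of_real)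
  finally show ?case .
next
  case (Suc k)
  have "cint (\<lambda>\<omega>. cavg m (\<omega> n)) x = (\<Sum>y\<in>children x. cint (\<lambda>\<omega>. cavg m (\<omega> n)) y)"
    by (rule cint_children) (rule integrable_level)
  also have "\<dots> = (\<Sum>y\<in>children x. m y)"
    using Suc.hyps by (intro sum.cong refl Suc.hyps(1)) (auto simp: children_lev)
  finally show ?case using m[of x] by simp
qed

text \<open>The increment has integral zero over every cylinder of level \<open>n\<close>, and so is orthogonal to the functions
that are constant on these cylinders.\<close>

lemma martingale_orthogonality:
  assumes m: "\<And>x. m x = (\<Sum>y\<in>children x. m y)" and nk: "n \<le> k"
  shows "(LINT \<omega>|\<nu>. norm (cavg m (\<omega> k) - cavg m (\<omega> n)) ^ 2)
    = (LINT \<omega>|\<nu>. norm (cavg m (\<omega> k)) ^ 2) - (LINT \<omega>|\<nu>. norm (cavg m (\<omega> n)) ^ 2)"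
    and "integrable \<nu> (\<lambda>\<omega>. norm (cavg m (\<omega> k) - cavg m (\<omega> n)) ^ 2)"
proof -
  define g where "g = (\<lambda>\<omega>. cavg m (\<omega> k) - cavg m (\<omega> n))"
  have g: "integrable \<nu> g" unfolding g_def
    by (intro Bochner_Integration.integrable_diff integrable_level)
  have g0: "cint g x = 0" if "x \<in> tsphere n" for x
  proof -
    have "cint g x = cint (\<lambda>\<omega>. cavg m (\<omega> k)) x - cint (\<lambda>\<omega>. cavg m (\<omega> n)) x"
      unfolding cint_def g_def scaleR_diff_right
      by (rule Bochner_Integration.integral_diff) (intro integrable_cyl integrable_level)+
    thus ?thesis using that nk by (simp add: cint_level_martingale[OF m] tsphere_def)
  qed
  have eq: "g \<omega> * cnj (cavg m (\<omega> n)) = (\<Sum>x\<in>tsphere n. cnj (cavg m x) * (indicat_real (cyl x) \<omega> *\<^sub>R g \<omega>))"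
    if "\<omega> \<in> \<Omega>" for \<omega>
    using level_sum[OF that, of "\<lambda>x. cnj (cavg m x) * g \<omega>" n] by (simp add: mult.commute)
  have ig: "integrable \<nu> (\<lambda>\<omega>. g \<omega> * cnj (cavg m (\<omega> n)))"
  proof -
    have "integrable \<nu> (\<lambda>\<omega>. \<Sum>x\<in>tsphere n. cnj (cavg m x) * (indicat_real (cyl x) \<omega> *\<^sub>R g \<omega>))"
      by (intro Bochner_Integration.integrable_sum integrable_mult_right integrable_cyl g)
    moreover have "integrable \<nu> (\<lambda>\<omega>. g \<omega> * cnj (cavg m (\<omega> n))) \<longleftrightarrow>
        integrable \<nu> (\<lambda>\<omega>. \<Sum>x\<in>tsphere n. cnj (cavg m x) * (indicat_real (cyl x) \<omega> *\<^sub>R g \<omega>))"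
      by (intro Bochner_Integration.integrable_cong refl eq) (simp add: space_\<nu>)
    ultimately show ?thesis by blast
  qed
  have "(LINT \<omega>|\<nu>. g \<omega> * cnj (cavg m (\<omega> n)))
      = (LINT \<omega>|\<nu>. (\<Sum>x\<in>tsphere n. cnj (cavg m x) * (indicat_real (cyl x) \<omega> *\<^sub>R g \<omega>)))"
    by (intro Bochner_Integration.integral_cong refl eq) (simp add: space_\<nu>)
  also have "\<dots> = (\<Sum>x\<in>tsphere n. (LINT \<omega>|\<nu>. cnj (cavg m x) * (indicat_real (cyl x) \<omega> *\<^sub>R g \<omega>)))"
    by (intro Bochner_Integration.integral_sum integrable_mult_right integrable_cyl g)
  also have "\<dots> = (\<Sum>x\<in>tsphere n. cnj (cavg m x) * cint g x)"
    unfolding cint_def by (simp only: integral_mult_right_zero)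
  also have "\<dots> = 0" using g0 by simp
  finally have orth: "(LINT \<omega>|\<nu>. g \<omega> * cnj (cavg m (\<omega> n))) = 0" .
  define h where "h \<omega> = Re (g \<omega> * cnj (cavg m (\<omega> n)))" for \<omega>
  have h: "integrable \<nu> h" "(LINT \<omega>|\<nu>. h \<omega>) = 0"
    unfolding h_def by (rule integrable_Re[OF ig]) (simp only: integral_Re[OF ig] orth zero_complex.sel)
  have pyth: "norm (g \<omega>) ^ 2 = norm (cavg m (\<omega> k)) ^ 2 - norm (cavg m (\<omega> n)) ^ 2 - 2 * h \<omega>" for \<omega>
    unfolding g_def h_def cmod_power2 by (simp add: power2_eq_square algebra_simps)
  have sq: "integrable \<nu> (\<lambda>\<omega>. norm (cavg m (\<omega> i)) ^ 2)" for i
    by (rule integrable_level[of "\<lambda>x. norm (cavg m x) ^ 2"])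
  have "integrable \<nu> (\<lambda>\<omega>. norm (g \<omega>) ^ 2)"
    unfolding pyth by (intro Bochner_Integration.integrable_diff integrable_mult_right sq h)
  thus "integrable \<nu> (\<lambda>\<omega>. norm (cavg m (\<omega> k) - cavg m (\<omega> n)) ^ 2)" by (simp add: g_def)
  have "(LINT \<omega>|\<nu>. norm (g \<omega>) ^ 2)
    = (LINT \<omega>|\<nu>. norm (cavg m (\<omega> k)) ^ 2) - (LINT \<omega>|\<nu>. norm (cavg m (\<omega> n)) ^ 2)"
    unfolding pyth using sq h by simp
  thus "(LINT \<omega>|\<nu>. norm (cavg m (\<omega> k) - cavg m (\<omega> n)) ^ 2)
    = (LINT \<omega>|\<nu>. norm (cavg m (\<omega> k)) ^ 2) - (LINT \<omega>|\<nu>. norm (cavg m (\<omega> n)) ^ 2)"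
    by (simp add: g_def)
qed

text \<open>On a probability space a bound in $L^r$ with $r \ge 2$ is a bound in $L^2$. By
orthogonality the squared $L^2$ distances are differences of a bounded monotone sequence,
so a subsequence has increments that are summable in $L^1$; it converges almost everywhere and in
$L^1$. Fatou's lemma transfers the bound in $L^r$ to the limit.\<close>

lemma Lp_bounded_martingale_closed:
  assumes r: "2 \<le> r" and m: "\<And>x. m x = (\<Sum>y\<in>children x. m y)"
    and M: "\<And>n. n \<noteq> 0 \<Longrightarrow> (LINT \<omega>|\<nu>. norm (cavg m (\<omega> n)) powr r) \<le> M"
  shows "\<exists>F\<in>Lp_space \<nu> r. (\<forall>x. cint F x = m x) \<and> (LINT \<omega>|\<nu>. norm (F \<omega>) powr r) \<le> M"
proof -
  define A where "A n = (LINT \<omega>|\<nu>. norm (cavg m (\<omega> n)) ^ 2)" for n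
  have A_diff: "A k - A n = (LINT \<omega>|\<nu>. norm (cavg m (\<omega> k) - cavg m (\<omega> n)) ^ 2)" if "n \<le> k" for n k
    unfolding A_def using martingale_orthogonality(1)[OF m that] by simp
  have "incseq A"
  proof (rule monoI)
    fix n k :: nat assume "n \<le> k"
    have "0 \<le> A k - A n" unfolding A_diff[OF \<open>n \<le> k\<close>] by (intro integral_nonneg_AE AE_I2) simp
    thus "A n \<le> A k" by simp
  qed
  have A_le: "A n \<le> 1 + M" for n
  proof -
    have sq_le: "x ^ 2 \<le> 1 + x powr r" if "0 \<le> x" for x :: real
    proof (cases "x \<le> 1")
      case True
      hence "x ^ 2 \<le> 1" using that by (intro power_le_one) auto
      thus ?thesis by (simp add: add_increasing2)
    next
      case False
      hence "x powr 2 \<le> x powr r" using r by (intro powr_mono) auto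
      thus ?thesis using False by simp
    qed
    have "A n \<le> A (Suc n)" using \<open>incseq A\<close> by (simp add: incseq_SucD)
    also have "A (Suc n) \<le> (LINT \<omega>|\<nu>. 1 + norm (cavg m (\<omega> (Suc n))) powr r)"
      unfolding A_def
      by (intro integral_mono integrable_level[of "\<lambda>x. norm (cavg m x) ^ 2"]
          integrable_level[of "\<lambda>x. 1 + norm (cavg m x) powr r"] sq_le) simp
    also have "\<dots> = 1 + (LINT \<omega>|\<nu>. norm (cavg m (\<omega> (Suc n))) powr r)"
      using integrable_level[of "\<lambda>x. norm (cavg m x) powr r" "Suc n"] prob_space by simp
    finally show ?thesis using M[of "Suc n"] by simp
  qed
  obtain L where "A \<longlonglongrightarrow> L" "\<forall>n. A n \<le> L"
    by (rule incseq_convergent[OF \<open>incseq A\<close>, of "1 + M"]) (simp add: A_le)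
  hence L: "A \<longlonglongrightarrow> L" "\<And>n. A n \<le> L" by simp_all
  have "\<forall>k. \<exists>N. \<forall>n\<ge>N. L - A n < (1 / 4) ^ k"
  proof
    fix k :: nat
    have "\<forall>\<^sub>F n in sequentially. L - (1 / 4) ^ k < A n"
      by (rule order_tendstoD(1)[OF L(1)]) simp
    then obtain N where N: "\<And>n. N \<le> n \<Longrightarrow> L - (1 / 4) ^ k < A n"
      unfolding eventually_sequentially by blast
    show "\<exists>N. \<forall>n\<ge>N. L - A n < (1 / 4) ^ k"
    proof (intro exI allI impI)
      fix n assume "N \<le> n"
      thus "L - A n < (1 / 4) ^ k" using N[of n] by linarith
    qed
  qed
  from choice[OF this] obtain N where N: "\<And>k n. N k \<le> n \<Longrightarrow> L - A n < (1 / 4) ^ k" by blast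
  \<comment> \<open>The sum makes \<open>j\<close> increasing; \<open>Suc k\<close> makes it unbounded and keeps it away from \<open>0\<close>, where \<open>M\<close> gives no bound.\<close>
  define j where "j k = (\<Sum>i\<le>k. N i) + Suc k" for k
  have j_Suc: "j k \<le> j (Suc k)" and j_ge: "N k \<le> j k" "k < j k" for k
  proof -
    have "N k \<le> (\<Sum>i\<le>k. N i)" by (rule member_le_sum) auto
    thus "N k \<le> j k" by (simp add: j_def)
  qed (simp_all add: j_def)
  define G where "G k \<omega> = cavg m (\<omega> (j k))" for k \<omega>
  define g where "g k \<omega> = G (Suc k) \<omega> - G k \<omega>" for k \<omega>
  have G: "integrable \<nu> (G k)" for k unfolding G_def by (rule integrable_level)
  have g: "integrable \<nu> (g k)" for k unfolding g_def by (intro Bochner_Integration.integrable_diff G)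
  have g_norm: "(LINT \<omega>|\<nu>. norm (g k \<omega>)) \<le> (1 / 2) ^ k" for k
  proof -
    have gi: "integrable \<nu> (\<lambda>\<omega>. norm (g k \<omega>) ^ 2)"
      unfolding g_def G_def by (rule martingale_orthogonality(2)[OF m j_Suc])
    have g2: "(LINT \<omega>|\<nu>. norm (g k \<omega>) ^ 2) \<le> (1 / 4) ^ k"
      using A_diff[OF j_Suc[of k]] N[OF j_ge(1)[of k]] L(2)[of "j (Suc k)"] by (simp add: g_def G_def)
    \<comment> \<open>The inequality of the means, weighted so that both terms contribute \<open>(1 / 2) ^ k / 2\<close> after integration.\<close>
    have "norm (g k \<omega>) \<le> (1 / 2) ^ k / 2 + 2 ^ k / 2 * norm (g k \<omega>) ^ 2" for \<omega>
    proof -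
      have "0 \<le> (2 ^ k * norm (g k \<omega>) - 1) ^ 2" by simp
      also have "\<dots> = 2 ^ k * (2 ^ k * norm (g k \<omega>) ^ 2 - 2 * norm (g k \<omega>) + (1 / 2) ^ k)"
        by (simp add: power2_eq_square algebra_simps power_one_over)
      finally have "0 \<le> 2 ^ k * norm (g k \<omega>) ^ 2 - 2 * norm (g k \<omega>) + (1 / 2) ^ k"
        using mult_le_cancel_left_pos[of "2 ^ k" 0 "2 ^ k * norm (g k \<omega>) ^ 2 - 2 * norm (g k \<omega>) + (1 / 2) ^ k"]
        by simp
      thus ?thesis by simp
    qed
    hence "(LINT \<omega>|\<nu>. norm (g k \<omega>)) \<le> (LINT \<omega>|\<nu>. (1 / 2) ^ k / 2 + 2 ^ k / 2 * norm (g k \<omega>) ^ 2)"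
      by (intro integral_mono integrable_norm g Bochner_Integration.integrable_add
          integrable_mult_right gi) auto
    also have "\<dots> = (1 / 2) ^ k / 2 + 2 ^ k / 2 * (LINT \<omega>|\<nu>. norm (g k \<omega>) ^ 2)"
      using gi prob_space by simp
    also have "\<dots> \<le> (1 / 2) ^ k / 2 + 2 ^ k / 2 * (1 / 4) ^ k"
      using g2 by (intro add_left_mono mult_left_mono) auto
    also have "2 ^ k / 2 * (1 / 4 :: real) ^ k = (1 / 2) ^ k / 2"
      by (simp add: power_mult_distrib[symmetric])
    finally show ?thesis by simp
  qed
  have sum_norm: "summable (\<lambda>k. LINT \<omega>|\<nu>. norm (g k \<omega>))"
    by (rule summable_comparison_test'[OF summable_geometric[of "1 / 2 :: real"], of 0])
      (use g_norm in \<open>auto simp: integral_nonneg_AE\<close>)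
  have AE_sum: "AE \<omega> in \<nu>. summable (\<lambda>k. norm (g k \<omega>))"
  proof -
    have [measurable]: "g k \<in> borel_measurable \<nu>" for k using g by (rule borel_measurable_integrable)
    have "(\<integral>\<^sup>+\<omega>. (\<Sum>k. ennreal (norm (g k \<omega>))) \<partial>\<nu>) = (\<Sum>k. \<integral>\<^sup>+\<omega>. ennreal (norm (g k \<omega>)) \<partial>\<nu>)"
      by (rule nn_integral_suminf) measurable
    also have "\<dots> = (\<Sum>k. ennreal (LINT \<omega>|\<nu>. norm (g k \<omega>)))"
      by (intro suminf_cong nn_integral_eq_integral integrable_norm g) auto
    also have "\<dots> \<noteq> \<infinity>"
      unfolding infinity_ennreal_def
      by (rule ennreal_suminf_neq_top[OF sum_norm]) (intro integral_nonneg_AE AE_I2 norm_ge_zero)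
    finally have "AE \<omega> in \<nu>. (\<Sum>k. ennreal (norm (g k \<omega>))) \<noteq> \<infinity>"
      by (intro nn_integral_PInf_AE) measurable
    thus ?thesis by (rule AE_mp) (auto intro!: AE_I2 summable_suminf_not_top)
  qed
  define F where "F \<omega> = G 0 \<omega> + (\<Sum>k. g k \<omega>)" for \<omega>
  have sg: "integrable \<nu> (\<lambda>\<omega>. \<Sum>k. g k \<omega>)" by (rule integrable_suminf[OF g AE_sum sum_norm])
  have F: "integrable \<nu> F" unfolding F_def by (intro Bochner_Integration.integrable_add G sg)
  have cintF: "cint F x = m x" for x
  proof -
    let ?I = "indicat_real (cyl x)"
    have cg: "cint (g k) x = cint (G (Suc k)) x - cint (G k) x" for k
      unfolding cint_def g_def scaleR_diff_right
      by (rule Bochner_Integration.integral_diff) (intro integrable_cyl G)+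
    have "(\<lambda>k. cint (g k) x) sums (LINT \<omega>|\<nu>. (\<Sum>k. ?I \<omega> *\<^sub>R g k \<omega>))"
      unfolding cint_def
    proof (rule sums_integral)
      show "integrable \<nu> (\<lambda>\<omega>. ?I \<omega> *\<^sub>R g k \<omega>)" for k by (rule integrable_cyl[OF g])
      show "AE \<omega> in \<nu>. summable (\<lambda>k. norm (?I \<omega> *\<^sub>R g k \<omega>))"
        using AE_sum by eventually_elim (simp add: summable_mult)
      have le: "(LINT \<omega>|\<nu>. norm (?I \<omega> *\<^sub>R g k \<omega>)) \<le> (LINT \<omega>|\<nu>. norm (g k \<omega>))" for k
        by (intro integral_mono integrable_norm integrable_cyl g) (simp add: indicator_def)
      show "summable (\<lambda>k. LINT \<omega>|\<nu>. norm (?I \<omega> *\<^sub>R g k \<omega>))"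
        by (rule summable_comparison_test'[OF sum_norm, of 0]) (use le in \<open>simp add: integral_nonneg_AE\<close>)
    qed
    moreover have "(LINT \<omega>|\<nu>. (\<Sum>k. ?I \<omega> *\<^sub>R g k \<omega>)) = cint F x - cint (G 0) x"
    proof -
      have "(LINT \<omega>|\<nu>. (\<Sum>k. ?I \<omega> *\<^sub>R g k \<omega>)) = (LINT \<omega>|\<nu>. ?I \<omega> *\<^sub>R F \<omega> - ?I \<omega> *\<^sub>R G 0 \<omega>)"
        by (intro Bochner_Integration.integral_cong refl) (simp add: F_def indicator_def)
      also have "\<dots> = cint F x - cint (G 0) x"
        unfolding cint_def by (intro Bochner_Integration.integral_diff integrable_cyl F G)
      finally show ?thesis .
    qed
    ultimately have "(\<lambda>n. \<Sum>k<n. cint (g k) x) \<longlonglongrightarrow> cint F x - cint (G 0) x"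
      by (simp add: sums_def)
    hence "(\<lambda>n. cint (G n) x - cint (G 0) x) \<longlonglongrightarrow> cint F x - cint (G 0) x"
      by (simp add: cg sum_lessThan_telescope[of "\<lambda>k. cint (G k) x"])
    moreover have "(\<lambda>n. cint (G n) x - cint (G 0) x) \<longlonglongrightarrow> m x - cint (G 0) x"
    proof (rule tendsto_eventually)
      have "cint (G n) x = m x" if "lev x \<le> n" for n
        unfolding G_def using j_ge(2)[of n] that by (intro cint_level_martingale m) simp
      thus "\<forall>\<^sub>F n in sequentially. cint (G n) x - cint (G 0) x = m x - cint (G 0) x"
        by (auto simp: eventually_sequentially)
    qed
    ultimately have "cint F x - cint (G 0) x = m x - cint (G 0) x" by (rule LIMSEQ_unique)
    thus ?thesis by simp
  qed
  have conv: "AE \<omega> in \<nu>. (\<lambda>k. G k \<omega>) \<longlonglongrightarrow> F \<omega>"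
    using AE_sum
  proof eventually_elim
    case (elim \<omega>)
    hence "(\<lambda>k. g k \<omega>) sums (\<Sum>k. g k \<omega>)" by (rule summable_sums[OF summable_norm_cancel])
    hence "(\<lambda>n. G n \<omega> - G 0 \<omega>) \<longlonglongrightarrow> (\<Sum>k. g k \<omega>)"
      by (simp add: sums_def g_def sum_lessThan_telescope[of "\<lambda>k. G k \<omega>"])
    hence "(\<lambda>n. G 0 \<omega> + (G n \<omega> - G 0 \<omega>)) \<longlonglongrightarrow> G 0 \<omega> + (\<Sum>k. g k \<omega>)"
      by (intro tendsto_add tendsto_const)
    thus ?case by (simp add: F_def)
  qed
  have [measurable]: "F \<in> borel_measurable \<nu>" "G k \<in> borel_measurable \<nu>" for k
    using F G by (auto intro: borel_measurable_integrable)
  have M0: "0 \<le> M" using order_trans[OF integral_nonneg_AE[OF AE_I2] M[of 1]] by simp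
  have "(\<integral>\<^sup>+\<omega>. ennreal (norm (F \<omega>) powr r) \<partial>\<nu>)
      = (\<integral>\<^sup>+\<omega>. liminf (\<lambda>k. ennreal (norm (G k \<omega>) powr r)) \<partial>\<nu>)"
  proof (rule nn_integral_cong_AE)
    show "AE \<omega> in \<nu>. ennreal (norm (F \<omega>) powr r) = liminf (\<lambda>k. ennreal (norm (G k \<omega>) powr r))"
      using conv
    proof eventually_elim
      case (elim \<omega>)
      have "(\<lambda>k. norm (G k \<omega>) powr r) \<longlonglongrightarrow> norm (F \<omega>) powr r"
        using r by (intro tendsto_powr' tendsto_norm elim tendsto_const) auto
      hence "(\<lambda>k. ennreal (norm (G k \<omega>) powr r)) \<longlonglongrightarrow> ennreal (norm (F \<omega>) powr r)"
        by (rule tendsto_ennrealI)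
      thus ?case by (rule lim_imp_Liminf[OF trivial_limit_sequentially, symmetric])
    qed
  qed
  also have "\<dots> \<le> liminf (\<lambda>k. \<integral>\<^sup>+\<omega>. ennreal (norm (G k \<omega>) powr r) \<partial>\<nu>)"
    by (rule nn_integral_liminf) measurable
  also have "\<dots> \<le> ennreal M"
  proof -
    have "(\<integral>\<^sup>+\<omega>. ennreal (norm (G k \<omega>) powr r) \<partial>\<nu>) \<le> ennreal M" for k
    proof -
      have "(\<integral>\<^sup>+\<omega>. ennreal (norm (G k \<omega>) powr r) \<partial>\<nu>) = ennreal (LINT \<omega>|\<nu>. norm (G k \<omega>) powr r)"
        unfolding G_def
        by (intro nn_integral_eq_integral integrable_level[of "\<lambda>x. norm (cavg m x) powr r"]) auto
      also have "\<dots> \<le> ennreal M"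
        unfolding G_def using j_ge(2)[of k] by (intro ennreal_leI M) simp
      finally show ?thesis .
    qed
    hence "liminf (\<lambda>k. \<integral>\<^sup>+\<omega>. ennreal (norm (G k \<omega>) powr r) \<partial>\<nu>) \<le> liminf (\<lambda>k. ennreal M)"
      by (intro Liminf_mono always_eventually) blast
    thus ?thesis by (simp add: Liminf_const)
  qed
  finally have fatou: "(\<integral>\<^sup>+\<omega>. ennreal (norm (F \<omega>) powr r) \<partial>\<nu>) \<le> ennreal M" .
  have Fr: "integrable \<nu> (\<lambda>\<omega>. norm (F \<omega>) powr r)"
    using le_less_trans[OF fatou ennreal_less_top] by (intro integrableI_bounded) auto
  have "ennreal (LINT \<omega>|\<nu>. norm (F \<omega>) powr r) \<le> ennreal M"
    using fatou by (subst nn_integral_eq_integral[symmetric, OF Fr]) auto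
  hence "(LINT \<omega>|\<nu>. norm (F \<omega>) powr r) \<le> M" using M0 by simp
  moreover have "F \<in> Lp_space \<nu> r" using Fr by (simp add: Lp_space_def)
  ultimately show ?thesis using cintF by blast
qed

end

section \<open>The representation theorem\<close>

context poisson_exponent begin

lemma qp_factor: "1 - qp (-s) ^ 2 \<noteq> 0"
proof
  assume "1 - qp (-s) ^ 2 = 0"
  hence "norm (qp (-s)) ^ 2 = 1" by (metis eq_iff_diff_eq_0 norm_one norm_power)
  moreover have "(1 / a) ^ 2 < 1" using one_less_power[OF a_gt_1, of 2] a_pos by (simp add: power_divide)
  ultimately show False by (simp add: norm_qp)
qed

text \<open>The first two factors convert slopes into averages of \<open>F\<close> over cylinders; the last one combines
\<open>tsphere_sum_le_weak_bound\<close> with \<open>weak_bound_slope\<close>.\<close>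

definition C_low :: real where
  "C_low = norm (1 / (1 - qp (-s) ^ 2)) powr r * ((real q + 1) / real q) powr (r - 1) *
     (real q * 2 powr r * (2 / (1 - 2 powr (1 - r))) * ((real q + 2) * 2 powr r))"

lemma C_low_pos: "0 < C_low"
proof -
  have "2 powr (1 - r) < 2 powr (0::real)" using r by (intro powr_less_mono) auto
  hence "0 < 1 - 2 powr (1 - r)" by simp
  thus ?thesis using qp_factor unfolding C_low_def
    by (intro mult_pos_pos divide_pos_pos) auto
qed

text \<open>By \<open>slope_PT\<close> there is only one candidate for the integral of \<open>F\<close> over the cylinder of \<open>x\<close>, namely
\<open>m x\<close> below. On the sphere of radius $n$, the power $q^{-sn}$ in \<open>m\<close> and the measures of the
cylinders cancel, so that the $L^r$ norm of the martingale is a constant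
multiple of the $\ell^r$ norm of the slopes.\<close>

lemma eigenfunction_represented:
  assumes z: "s = 1/2 + \<i> * z" and eig: "\<And>x. laplacian adj q u x = gamma_eigenvalue q z * u x"
    and W: "weak_bound r B u"
  shows "\<exists>F\<in>Lp_space \<nu> r. u = PT s F \<and> (LINT \<omega>|\<nu>. norm (F \<omega>) powr r) \<le> C_low * B"
proof -
  define d where "d = slope s u"
  define \<kappa> where "\<kappa> = 1 / (1 - qp (-s) ^ 2)"
  define m where "m x = (if x = orig then u orig else \<kappa> * qp (-s) ^ lev x * d x)" for x
  have inv: "qp s * qp (-s) = 1" by (simp add: powr_minus qp_nonzero)
  have d_orig: "(\<Sum>y\<in>children orig. d y) = (qp s - qp (-s)) * u orig"
    and d_add: "\<And>x. x \<noteq> orig \<Longrightarrow> (\<Sum>y\<in>children x. d y) = qp s * d x"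
    using eigenfunction_iff_slope[OF z, of u] eig unfolding d_def by auto
  have m_children: "(\<Sum>y\<in>children x. m y) = \<kappa> * qp (-s) ^ Suc (lev x) * (\<Sum>y\<in>children x. d y)" for x
    unfolding sum_distrib_left
    by (intro sum.cong refl) (auto simp: m_def children_lev dest: children_not_orig)
  have m_add: "m x = (\<Sum>y\<in>children x. m y)" for x
  proof (cases "x = orig")
    case True
    \<comment> \<open>The condition at the root is what makes \<open>u orig\<close> the total mass.\<close>
    have "\<kappa> * qp (-s) * ((qp s - qp (-s)) * u orig) = \<kappa> * (qp s * qp (-s) - qp (-s) ^ 2) * u orig"
      by (simp add: power2_eq_square algebra_simps)
    also have "\<dots> = u orig" using qp_factor by (simp add: inv \<kappa>_def)
    finally show ?thesis unfolding m_children by (simp add: True d_orig m_def)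
  next
    case False
    have "\<kappa> * qp (-s) ^ Suc (lev x) * (qp s * d x) = \<kappa> * qp (-s) ^ lev x * d x * (qp s * qp (-s))"
      by (simp add: mult_ac)
    thus ?thesis unfolding m_children d_add[OF False] by (simp add: m_def False inv)
  qed
  have d_weak: "weak_bound r ((real q + 2) * 2 powr r * B) d"
    unfolding d_def using Re_s_pos by (intro weak_bound_slope W) simp
  have bound: "(LINT \<omega>|\<nu>. norm (cavg m (\<omega> n)) powr r) \<le> C_low * B" if n: "n \<noteq> 0" for n
  proof -
    have "(LINT \<omega>|\<nu>. norm (cavg m (\<omega> n)) powr r)
        = (\<Sum>x\<in>tsphere n. measure \<nu> (cyl x) *\<^sub>R (norm (cavg m x) powr r))"
      by (rule integral_level[of "\<lambda>x. norm (cavg m x) powr r"])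
    also have "\<dots> = (\<Sum>x\<in>tsphere n. norm \<kappa> powr r * ((real q + 1) / real q) powr (r - 1) * norm (d x) powr r)"
    proof (intro sum.cong refl)
      fix x assume "x \<in> tsphere n"
      hence lev: "lev x = n" by (simp add: tsphere_def)
      hence x: "x \<noteq> orig" using n by auto
      define \<mu> where "\<mu> = measure \<nu> (cyl x)"
      have \<mu>: "\<mu> = real q / (real q + 1) / real q ^ n" "0 < \<mu>"
        unfolding \<mu>_def using measure_cyl_pos by (simp_all add: measure_cyl[OF x] lev)
      have an: "a ^ n = (real q ^ n) powr (1 - 1 / r)"
        by (simp add: a_def s power_powr)
      have "\<mu> * norm (cavg m x) powr r = \<mu> * (norm (m x) / \<mu>) powr r"
        by (simp add: cavg_def norm_divide \<mu>_def)
      also have "\<dots> = norm (m x) powr r * \<mu> powr (-(r - 1))"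
      proof -
        have "\<mu> powr (-(r - 1)) = \<mu> / \<mu> powr r"
          using powr_diff[of \<mu> 1 r] \<mu>(2) by simp
        thus ?thesis using \<mu>(2) by (simp add: powr_divide)
      qed
      also have "norm (m x) = norm \<kappa> * norm (d x) / a ^ n"
        using x by (simp add: m_def lev norm_mult norm_power norm_qp power_one_over)
      also have "(norm \<kappa> * norm (d x) / a ^ n) powr r
          = norm \<kappa> powr r * norm (d x) powr r / (real q ^ n) powr (r - 1)"
      proof -
        have "(a ^ n) powr r = (real q ^ n) powr (r - 1)"
        proof -
          have "(1 - 1 / r) * r = r - 1" using r by (simp add: left_diff_distrib)
          thus ?thesis unfolding an by (simp only: powr_powr)
        qed
        thus ?thesis using a_pos by (simp add: powr_divide powr_mult)
      qed
      also have "\<mu> powr (-(r - 1)) = ((real q + 1) / real q) powr (r - 1) * (real q ^ n) powr (r - 1)"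
      proof -
        have "\<mu> powr (-(r - 1)) = (1 / \<mu>) powr (r - 1)"
          using \<mu>(2) powr_minus_divide[of \<mu> "r - 1"] by (simp add: powr_divide)
        also have "1 / \<mu> = (real q + 1) / real q * real q ^ n" by (simp add: \<mu>(1))
        finally show ?thesis by (simp only: powr_mult)
      qed
      finally show "measure \<nu> (cyl x) *\<^sub>R (norm (cavg m x) powr r)
          = norm \<kappa> powr r * ((real q + 1) / real q) powr (r - 1) * norm (d x) powr r"
        by (simp add: \<mu>_def)
    qed
    also have "\<dots> = norm \<kappa> powr r * ((real q + 1) / real q) powr (r - 1) * (\<Sum>x\<in>tsphere n. norm (d x) powr r)"
      by (simp add: sum_distrib_left)
    also have "\<dots> \<le> norm \<kappa> powr r * ((real q + 1) / real q) powr (r - 1) *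
        (real q * 2 powr r * (2 / (1 - 2 powr (1 - r))) * ((real q + 2) * 2 powr r * B))"
      using r s d_weak d_add n by (intro mult_left_mono tsphere_sum_le_weak_bound[of r s]) auto
    also have "\<dots> = C_low * B" by (simp only: C_low_def \<kappa>_def mult_ac)
    finally show ?thesis .
  qed
  have "\<exists>F\<in>Lp_space \<nu> r. (\<forall>x. cint F x = m x) \<and> (LINT \<omega>|\<nu>. norm (F \<omega>) powr r) \<le> C_low * B"
  proof (rule Lp_bounded_martingale_closed)
    show "2 \<le> r" using r by simp
    show "m x = (\<Sum>y\<in>children x. m y)" for x by (rule m_add)
    show "(LINT \<omega>|\<nu>. norm (cavg m (\<omega> n)) powr r) \<le> C_low * B" if "n \<noteq> 0" for n
      using that by (rule bound)
  qed
  then obtain F where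
    F: "F \<in> Lp_space \<nu> r" "\<And>x. cint F x = m x" "(LINT \<omega>|\<nu>. norm (F \<omega>) powr r) \<le> C_low * B"
    by blast
  have "u = PT s F"
  proof (rule eq_if_slope_eq)
    show "u orig = PT s F orig" unfolding PT_orig F(2) by (simp add: m_def)
    fix x assume x: "x \<noteq> orig"
    have "slope s (PT s F) x = (qp s * qp (-s)) ^ lev x * ((1 - qp (-s) ^ 2) * \<kappa>) * d x"
      unfolding slope_PT[OF integrable_Lp(1)[OF F(1)] x] F(2)
      using x by (simp add: m_def power_mult_distrib)
    also have "\<dots> = d x" using qp_factor by (simp add: inv \<kappa>_def)
    finally show "slope s u x = slope s (PT s F) x" by (simp add: d_def)
  qed
  thus ?thesis using F by blast
qed

lemma AE_eq_if_PT_eq: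
  assumes F: "F \<in> Lp_space \<nu> r" and G: "G \<in> Lp_space \<nu> r" and eq: "PT s F = PT s G"
  shows "AE \<omega> in \<nu>. F \<omega> = G \<omega>"
proof (rule AE_eq_if_cint_eq)
  fix x show "cint F x = cint G x"
  proof (cases "x = orig")
    case True
    thus ?thesis using fun_cong[OF eq, of orig] by (simp only: PT_orig)
  next
    case False
    have "qp s ^ lev x * (1 - qp (-s) ^ 2) * cint F x = qp s ^ lev x * (1 - qp (-s) ^ 2) * cint G x"
      using slope_PT[OF integrable_Lp(1)[OF F] False, of s] slope_PT[OF integrable_Lp(1)[OF G] False, of s]
      by (simp only: eq)
    moreover have "qp s ^ lev x * (1 - qp (-s) ^ 2) \<noteq> 0"
      by (intro no_zero_divisors power_not_zero qp_nonzero qp_factor)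
    ultimately show ?thesis using mult_left_cancel by blast
  qed
qed (use F G integrable_Lp in auto)

text \<open>The function that represents the transform of \<open>F\<close> satisfies the bound, and it agrees with \<open>F\<close> almost everywhere.\<close>

lemma Lp_le_weak_bound_PT:
  assumes z: "s = 1/2 + \<i> * z" and F: "F \<in> Lp_space \<nu> r" and W: "weak_bound r B (PT s F)"
  shows "(LINT \<omega>|\<nu>. norm (F \<omega>) powr r) \<le> C_low * B"
proof -
  from eigenfunction_represented[OF z PT_eigenfunction[OF z integrable_Lp(1)[OF F]] W]
  obtain G where G: "G \<in> Lp_space \<nu> r" "PT s F = PT s G" "(LINT \<omega>|\<nu>. norm (G \<omega>) powr r) \<le> C_low * B"
    by blast
  have ae: "AE \<omega> in \<nu>. F \<omega> = G \<omega>" by (rule AE_eq_if_PT_eq[OF F G(1,2)])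
  have "(LINT \<omega>|\<nu>. norm (F \<omega>) powr r) = (LINT \<omega>|\<nu>. norm (G \<omega>) powr r)"
  proof (rule integral_cong_AE)
    show "AE \<omega> in \<nu>. norm (F \<omega>) powr r = norm (G \<omega>) powr r" using ae by eventually_elim simp
  qed (use integrable_Lp(2)[OF F] integrable_Lp(2)[OF G(1)] in \<open>auto dest: borel_measurable_integrable\<close>)
  thus ?thesis using G(3) by simp
qed

lemma weak_Lp_norm_PT_le:
  assumes F: "F \<in> Lp_space \<nu> r"
  shows "weak_Lp_norm r (PT s F) \<le> ennreal (C_up powr (1 / r) * Lp_norm \<nu> r F)"
proof -
  have I: "0 \<le> (LINT \<omega>|\<nu>. norm (F \<omega>) powr r)" by (intro integral_nonneg_AE AE_I2) simp
  have "(C_up powr (1 / r) * Lp_norm \<nu> r F) powr r = C_up * (LINT \<omega>|\<nu>. norm (F \<omega>) powr r)"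
    using C_up_pos I r by (simp add: Lp_norm_def powr_mult powr_powr)
  thus ?thesis using weak_bound_PT[OF F] r weak_Lp_norm_le_iff[of r "C_up powr (1 / r) * Lp_norm \<nu> r F" "PT s F"]
    by (simp add: Lp_norm_def)
qed

lemma Lp_norm_le:
  assumes z: "s = 1/2 + \<i> * z" and F: "F \<in> Lp_space \<nu> r"
  shows "ennreal (Lp_norm \<nu> r F) \<le> ennreal (C_low powr (1 / r)) * weak_Lp_norm r (PT s F)"
proof -
  have "weak_Lp_norm r (PT s F) \<noteq> \<top>"
    using weak_Lp_norm_PT_le[OF F] by (auto simp: top_unique)
  then obtain A where A: "0 \<le> A" "weak_Lp_norm r (PT s F) = ennreal A"
    by (cases "weak_Lp_norm r (PT s F)") auto
  hence "weak_bound r (A powr r) (PT s F)" using r weak_Lp_norm_le_iff[of r A "PT s F"] by simp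
  from Lp_le_weak_bound_PT[OF z F this]
  have "(LINT \<omega>|\<nu>. norm (F \<omega>) powr r) \<le> C_low * A powr r" .
  hence "Lp_norm \<nu> r F \<le> (C_low * A powr r) powr (1 / r)"
    unfolding Lp_norm_def using r by (intro powr_mono2 integral_nonneg_AE AE_I2) auto
  also have "\<dots> = C_low powr (1 / r) * A" using r A(1) C_low_pos by (simp add: powr_mult powr_powr)
  finally show ?thesis using A by (simp add: ennreal_mult[symmetric])
qed

lemma poisson_representation:
  assumes z: "s = 1/2 + \<i> * z"
  shows "(\<exists>F\<in>Lp_space \<nu> r. u = PT s F) \<longleftrightarrow>
    u \<in> weak_Lp_space r \<and> (\<forall>x. laplacian adj q u x = gamma_eigenvalue q z * u x)"
proof
  assume "\<exists>F\<in>Lp_space \<nu> r. u = PT s F"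
  then obtain F where F: "F \<in> Lp_space \<nu> r" "u = PT s F" by blast
  have "weak_Lp_norm r u < \<infinity>"
    using le_less_trans[OF weak_Lp_norm_PT_le[OF F(1)] ennreal_less_top] by (simp add: F(2))
  moreover have "laplacian adj q u x = gamma_eigenvalue q z * u x" for x
    unfolding F(2) by (rule PT_eigenfunction[OF z integrable_Lp(1)[OF F(1)]])
  ultimately show "u \<in> weak_Lp_space r \<and> (\<forall>x. laplacian adj q u x = gamma_eigenvalue q z * u x)"
    by (simp add: weak_Lp_space_def)
next
  assume u: "u \<in> weak_Lp_space r \<and> (\<forall>x. laplacian adj q u x = gamma_eigenvalue q z * u x)"
  then obtain A where A: "0 \<le> A" "weak_Lp_norm r u = ennreal A"
    by (cases "weak_Lp_norm r u") (auto simp: weak_Lp_space_def)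
  hence "weak_bound r (A powr r) u" using r weak_Lp_norm_le_iff[of r A u] by simp
  thus "\<exists>F\<in>Lp_space \<nu> r. u = PT s F" using eigenfunction_represented[OF z] u by blast
qed

end

theorem theorem3p2:
  fixes adj :: "'v \<Rightarrow> 'v \<Rightarrow> bool" and q :: nat and orig :: 'v
    and \<nu> :: "(nat \<Rightarrow> 'v) measure"
    and p p' \<alpha> :: real and z :: complex
  assumes "2 \<le> q" and "homogeneous_tree adj q"
    and "is_boundary_measure adj q orig \<nu>"
    and "1 < p" and "p < 2" and "1 / p + 1 / p' = 1"
    and "z = complex_of_real \<alpha> + \<i> * complex_of_real (1 / p' - 1 / 2)"
  shows "(\<forall>u :: 'v \<Rightarrow> complex.
            (\<exists>F \<in> Lp_space \<nu> p'. u = poisson_transform adj q orig \<nu> z F) \<longleftrightarrow>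
            u \<in> weak_Lp_space p' \<and> (\<forall>x. laplacian adj q u x = gamma_eigenvalue q z * u x)) \<and>
         (\<exists>C1 C2 :: real. 0 < C1 \<and> 0 < C2 \<and>
            (\<forall>F \<in> Lp_space \<nu> p'.
               ennreal C1 * weak_Lp_norm p' (poisson_transform adj q orig \<nu> z F)
                 \<le> ennreal (Lp_norm \<nu> p' F) \<and>
               ennreal (Lp_norm \<nu> p' F)
                 \<le> ennreal C2 * weak_Lp_norm p' (poisson_transform adj q orig \<nu> z F)))"
proof -
  have p': "1 / p' = 1 - 1 / p" using assms(6) by simp
  have "0 < 1 / p'" "1 / p' < 1 / 2" unfolding p' using assms(4,5) by (simp_all add: field_simps)
  hence "0 < p'" "2 < p'" by (simp_all add: field_simps)
  define s where "s = 1/2 + \<i> * z"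
  have Re_s: "Re s = 1 - 1 / p'" by (simp add: s_def assms(7))
  interpret poisson_exponent adj q orig \<nu> s p'
    by unfold_locales (use assms \<open>2 < p'\<close> Re_s in auto)
  have PT: "poisson_transform adj q orig \<nu> z F = PT s F" for F
    by (simp add: poisson_transform_def s_def fun_eq_iff)
  have "ennreal (C_up powr (- 1 / p')) * weak_Lp_norm p' (PT s F) \<le> ennreal (Lp_norm \<nu> p' F)"
    if F: "F \<in> Lp_space \<nu> p'" for F
  proof -
    have "ennreal (C_up powr (- 1 / p')) * weak_Lp_norm p' (PT s F)
        \<le> ennreal (C_up powr (- 1 / p')) * ennreal (C_up powr (1 / p') * Lp_norm \<nu> p' F)"
      by (intro mult_left_mono weak_Lp_norm_PT_le F) simp
    also have "\<dots> = ennreal ((C_up powr (- 1 / p') * C_up powr (1 / p')) * Lp_norm \<nu> p' F)"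
      by (simp add: ennreal_mult[symmetric] Lp_norm_def mult.assoc)
    also have "C_up powr (- 1 / p') * C_up powr (1 / p') = 1"
      using C_up_pos by (simp add: powr_add[symmetric])
    finally show ?thesis by simp
  qed
  moreover have "0 < C_up powr (- 1 / p')" "0 < C_low powr (1 / p')"
    using C_up_pos C_low_pos by simp_all
  ultimately show ?thesis
    unfolding PT using poisson_representation[OF s_def] Lp_norm_le[OF s_def] by blast
qed

end
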